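(* Let $n\ge1$ and let $T\in S^4\mathbb{C}^{n+1}$ be a nonzero homogeneous polynomial of degree $4$ in $n+1$ variables. Let $A\subset\mathbb{P}^n$ be a finite set that computes $T$, such that $\ell(A)=2n+1$, $A$ is in linear general position, and $A$ is minimal for $T$. Let $B\subset\mathbb{P}^n$ be another finite set (i.e. $B\neq A$) that computes $T$, with $\ell(B)\le 2n+1$ and $B$ minimal for $T$. Then $Z=A\cup B$ is contained in a rational normal curve of $\mathbb{P}^n$.
   Context: $\mathbb{P}^n=\mathbb{P}^n_{\mathbb{C}}$; $S^4\mathbb{C}^{n+1}$ is the space of degree-4 forms in $n+1$ variables over $\mathbb{C}$, and a nonzero $T$ is identified with the point it defines in $\mathbb{P}(S^4\mathbb{C}^{n+1})$. $\nu_4:\mathbb{P}^n\to\mathbb{P}^N$, $N=\binom{n+4}{4}-1$, is the degree-4 Veronese embedding (sending the class of a linear form to the class of its fourth power). $\ell(A)$ is the cardinality of a finite set $A$. A finite set $A\subset\mathbb{P}^n$ computes $T$ if $T\in\langle\nu_4(A)\rangle$, the linear span of $\nu_4(A)$. A set $A$ computing $T$ is minimal for $T$ if there is no proper subset $A'\subsetneq A$ with $T\in\langle\nu_4(A')\rangle$. A finite set $A\subset\mathbb{P}^n$ is in linear general position if every subset of $A$ of cardinality at most $\min\{\ell(A),n+1\}$ is linearly independent. A rational normal curve in $\mathbb{P}^n$ is a curve which, up to a projective linear automorphism of $\mathbb{P}^n$, is the image of the degree-$n$ Veronese embedding of $\mathbb{P}^1$. *)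

theory Defs
  imports Complex_Main "HOL-Library.Poly_Mapping"
begin

text \<open>
  Complex polynomials in countably many variables, as finitely supported functions on
  exponent vectors; the product is convolution. Variables are indexed from 0, so
  that forms in $n+1$ variables only involve the variables with index at most \<open>n\<close>.
\<close>

type_synonym mpoly = "(nat \<Rightarrow>\<^sub>0 nat) \<Rightarrow>\<^sub>0 complex"

definition pscale :: "complex \<Rightarrow> mpoly \<Rightarrow> mpoly" where
  "pscale c = Poly_Mapping.map ((*) c)"

lemma lookup_pscale: "Poly_Mapping.lookup (pscale c p) m = c * Poly_Mapping.lookup p m"
  by (simp add: pscale_def Poly_Mapping.map.rep_eq when_def)

lemma pscale_conv_mult: "pscale c p = Poly_Mapping.single 0 c * p"
  by (simp add: pscale_def mult_map_scale_conv_mult)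

interpretation mp: vector_space pscale
  by unfold_locales
    (rule poly_mapping_eqI, simp add: lookup_pscale lookup_add algebra_simps)+

text \<open>\<open>forms d n\<close> is the space of degree \<open>d\<close> forms in $n+1$ variables, zero form included.\<close>

definition forms :: "nat \<Rightarrow> nat \<Rightarrow> mpoly set" where
  "forms d n = {p. \<forall>m \<in> Poly_Mapping.keys p. Poly_Mapping.keys m \<subseteq> {..n} \<and>
                     (\<Sum>i \<in> Poly_Mapping.keys m. Poly_Mapping.lookup m i) = d}"

text \<open>
  A point of the projectivization of \<open>V\<close> is a line through the origin, i.e. a one-dimensional
  subspace. \<open>Pn n\<close> is the space of classes of linear forms in $n+1$ variables.
\<close>

definition proj_point :: "mpoly \<Rightarrow> mpoly set" where
  "proj_point v = mp.span {v}"

definition proj :: "mpoly set \<Rightarrow> mpoly set set" where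
  "proj V = {proj_point v | v. v \<in> V \<and> v \<noteq> 0}"

definition Pn :: "nat \<Rightarrow> mpoly set set" where
  "Pn n = proj (forms 1 n)"

text \<open>The smallest projective linear subspace containing a set of points.\<close>

definition proj_span :: "mpoly set set \<Rightarrow> mpoly set set" where
  "proj_span X = proj (mp.span (\<Union>X))"

text \<open>
  The powers \<open>L ^ d\<close> of the vectors \<open>L\<close> of a line all lie on one line; the span only serves to
  name it (see \<open>veronese_proj_point\<close>).
\<close>

definition veronese :: "nat \<Rightarrow> mpoly set \<Rightarrow> mpoly set" where
  "veronese d x = mp.span ((\<lambda>L. L ^ d) ` x)"

lemma pscale_power: "pscale c p ^ d = pscale (c ^ d) (p ^ d)"
proof -
  have "Poly_Mapping.single 0 c ^ d = (Poly_Mapping.single 0 (c ^ d) :: mpoly)"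
    by (induction d) (simp_all add: mult_single)
  then show ?thesis
    by (simp add: pscale_conv_mult power_mult_distrib)
qed

lemma veronese_proj_point: "veronese d (proj_point L) = proj_point (L ^ d)"
proof -
  have "(\<lambda>L. L ^ d) ` proj_point L \<subseteq> mp.span {L ^ d}"
  proof
    fix y assume "y \<in> (\<lambda>L. L ^ d) ` proj_point L"
    then obtain c where "y = pscale c L ^ d"
      unfolding proj_point_def mp.span_singleton by blast
    then show "y \<in> mp.span {L ^ d}"
      by (simp only: pscale_power mp.span_singleton) (rule rangeI)
  qed
  then have "veronese d (proj_point L) \<subseteq> mp.span {L ^ d}"
    unfolding veronese_def by (rule mp.span_minimal) (rule mp.subspace_span)
  moreover have "L \<in> proj_point L"
    unfolding proj_point_def by (rule mp.span_base) (rule singletonI)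
  then have "{L ^ d} \<subseteq> (\<lambda>L. L ^ d) ` proj_point L"
    by blast
  then have "mp.span {L ^ d} \<subseteq> veronese d (proj_point L)"
    unfolding veronese_def by (rule mp.span_mono)
  ultimately show ?thesis
    unfolding proj_point_def by (rule subset_antisym)
qed

definition computes :: "nat \<Rightarrow> mpoly set set \<Rightarrow> mpoly \<Rightarrow> bool" where
  "computes n A T \<longleftrightarrow>
     finite A \<and> A \<subseteq> Pn n \<and> proj_point T \<in> proj_span (veronese 4 ` A)"

definition minimal_for :: "mpoly set set \<Rightarrow> mpoly \<Rightarrow> bool" where
  "minimal_for A T \<longleftrightarrow>
     \<not> (\<exists>A'. A' \<subset> A \<and> proj_point T \<in> proj_span (veronese 4 ` A'))"

text \<open>
  Points are linearly independent if representatives of them are. For pairwise distinct lines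
  the choice function \<open>r\<close> is automatically injective, so \<open>r ` S\<close> has as many elements as \<open>S\<close>.
\<close>

definition points_independent :: "mpoly set set \<Rightarrow> bool" where
  "points_independent S \<longleftrightarrow>
     (\<forall>r. (\<forall>x \<in> S. r x \<in> x - {0}) \<longrightarrow> mp.independent (r ` S))"

definition linear_general_position :: "nat \<Rightarrow> mpoly set set \<Rightarrow> bool" where
  "linear_general_position n A \<longleftrightarrow>
     finite A \<and> A \<subseteq> Pn n \<and>
     (\<forall>S \<subseteq> A. card S \<le> min (card A) (n + 1) \<longrightarrow> points_independent S)"

text \<open>
  The degree \<open>n\<close> Veronese embedding of the projective line takes values in the projectivization
  of \<open>forms n 1\<close>, the space of binary forms of degree \<open>n\<close>, which has dimension $n+1$. The map
  \<open>\<phi>\<close> combines an identification of that space with the projective space \<open>Pn n\<close>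
  and a projective linear automorphism of \<open>Pn n\<close>. Only its restriction to \<open>forms n 1\<close> matters.
\<close>

definition rational_normal_curve :: "nat \<Rightarrow> mpoly set set \<Rightarrow> bool" where
  "rational_normal_curve n C \<longleftrightarrow>
     (\<exists>\<phi>. Vector_Spaces.linear pscale pscale \<phi> \<and> bij_betw \<phi> (forms n 1) (forms 1 n) \<and>
          C = (\<lambda>x. \<phi> ` veronese n x) ` Pn 1)"

end

theory Submission
  imports Defs "HOL-Library.Function_Algebras"
begin

text \<open>
  Contract the two expressions of \<open>T\<close>, as sums of fourth powers over \<open>A\<close> and over \<open>B\<close>, with a
  product of two linear functionals vanishing at all points of \<open>A\<close> but one. This shows that the
  squares of the points of \<open>A\<close> and of \<open>B\<close> span the same space, so that for \<open>b\<close> in \<open>B - A\<close> the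
  tensor \<open>b \<otimes> b\<close> is a combination of the \<open>a \<otimes> a\<close>; general position forces all its coefficients
  to be nonzero, and the quartic relation forces \<open>B - A\<close> to have at least two elements. Choose
  $n+1$ points of \<open>A\<close> as a basis and let \<open>c\<close> be one of the $n$ others. Eliminating the basis
  vectors from the relations for \<open>b\<close> and \<open>b'\<close> shows that the coordinatewise inverses of
  \<open>b\<close>, \<open>b'\<close> and \<open>c\<close> are collinear. So all remaining points have their inverses on one line,
  whose image under coordinatewise inversion is a rational normal curve through the basis points.
\<close>

subsection \<open>Linear functionals and polarization\<close>

text \<open>A vector of \<open>T\<close> outside \<open>span S\<close> could be added to
  \<open>S\<close>, giving an independent set larger than the spanning set \<open>T\<close>. Stated
  for any vector space because it serves both linear forms and square tensors.\<close>

lemma (in vector_space) independent_spanning: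
  assumes "finite T" "independent S" "S \<subseteq> span T" "card T \<le> card S"
  shows "span T \<subseteq> span S"
proof (rule span_minimal)
  show "T \<subseteq> span S"
  proof (rule ccontr)
    assume "\<not> T \<subseteq> span S"
    then obtain x where x: "x \<in> T" "x \<notin> span S" by blast
    have "finite S" using independent_span_bound[OF assms(1-3)] by blast
    moreover have "x \<notin> S" using x(2) span_base by blast
    moreover have "independent (insert x S)"
      using x(2) assms(2) by (rule independent_insertI)
    moreover have "insert x S \<subseteq> span T"
      using x(1) assms(3) span_base by blast
    ultimately show False
      using independent_span_bound[OF assms(1), of "insert x S"] assms(4) by simp
  qed
qed (rule subspace_span)

abbreviation functional :: "(mpoly \<Rightarrow> complex) \<Rightarrow> bool" where
  "functional \<equiv> Vector_Spaces.linear pscale (*)"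

interpretation mpf: vector_space_pair pscale "(*) :: complex \<Rightarrow> complex \<Rightarrow> complex"
  by unfold_locales (simp_all add: algebra_simps)

declare mpf.vs2.scale_scale [simp del]

interpretation mpp: vector_space_pair pscale pscale ..

lemma functionalI:
  assumes "\<And>p q. h (p + q) = h p + h q" "\<And>c p. h (pscale c p) = c * h p"
  shows "functional h"
  by (rule Vector_Spaces.linear.intro[OF mp.vector_space_axioms mpf.vs2.vector_space_axioms], unfold_locales)
     (simp_all add: assms)

lemma functional_lookup: "functional (\<lambda>p. Poly_Mapping.lookup p m)"
  by (rule functionalI) (simp_all add: lookup_add lookup_pscale)

text \<open>Coefficient functionals already separate polynomials. This turns scalar identities valid
  for every functional into identities between vectors.\<close>

lemma functional_eqI:
  assumes "\<And>k. functional k \<Longrightarrow> k u = k v"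
  shows "u = v"
  by (rule poly_mapping_eqI) (rule assms[OF functional_lookup])

lemmas functional_simps = mpf.linear_add mpf.linear_diff mpf.linear_scale mpf.linear_sum mpf.linear_0

section \<open>Evaluation of polynomials at a point\<close>

definition mon_eval :: "(nat \<Rightarrow> complex) \<Rightarrow> (nat \<Rightarrow>\<^sub>0 nat) \<Rightarrow> complex" where
  "mon_eval x m = (\<Prod>i\<in>Poly_Mapping.keys m. x i ^ Poly_Mapping.lookup m i)"

definition poly_eval :: "(nat \<Rightarrow> complex) \<Rightarrow> mpoly \<Rightarrow> complex" where
  "poly_eval x p = (\<Sum>m\<in>Poly_Mapping.keys p. Poly_Mapping.lookup p m * mon_eval x m)"

lemma mon_eval_superset:
  assumes "finite K" "Poly_Mapping.keys m \<subseteq> K"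
  shows "mon_eval x m = (\<Prod>i\<in>K. x i ^ Poly_Mapping.lookup m i)"
  unfolding mon_eval_def using assms
  by (intro prod.mono_neutral_left) (auto simp: in_keys_iff)

lemma mon_eval_add: "mon_eval x (m + m') = mon_eval x m * mon_eval x m'"
proof -
  let ?K = "Poly_Mapping.keys m \<union> Poly_Mapping.keys m'"
  have "Poly_Mapping.keys (m + m') \<subseteq> ?K" by (rule keys_add)
  then show ?thesis
    by (simp add: mon_eval_superset[of ?K] lookup_add power_add prod.distrib)
qed

lemma poly_eval_superset:
  assumes "finite K" "Poly_Mapping.keys p \<subseteq> K"
  shows "poly_eval x p = (\<Sum>m\<in>K. Poly_Mapping.lookup p m * mon_eval x m)"
  unfolding poly_eval_def using assms
  by (intro sum.mono_neutral_left) (auto simp: in_keys_iff)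

lemma functional_poly_eval: "functional (poly_eval x)"
proof (rule functionalI)
  fix p q :: mpoly
  let ?K = "Poly_Mapping.keys p \<union> Poly_Mapping.keys q"
  have "Poly_Mapping.keys (p + q) \<subseteq> ?K" by (rule keys_add)
  then show "poly_eval x (p + q) = poly_eval x p + poly_eval x q"
    by (simp add: poly_eval_superset[of ?K] lookup_add ring_distribs sum.distrib)
next
  fix c and p :: mpoly
  have "Poly_Mapping.keys (pscale c p) \<subseteq> Poly_Mapping.keys p"
    by (auto simp: in_keys_iff lookup_pscale)
  then show "poly_eval x (pscale c p) = c * poly_eval x p"
    by (simp add: poly_eval_superset[of "Poly_Mapping.keys p"] lookup_pscale sum_distrib_left mult.assoc)
qed

lemma poly_eval_single: "poly_eval x (Poly_Mapping.single m c) = c * mon_eval x m"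
  by (simp add: poly_eval_def)

lemma sum_monomials:
  fixes p :: mpoly
  shows "p = (\<Sum>m\<in>Poly_Mapping.keys p. Poly_Mapping.single m (Poly_Mapping.lookup p m))"
  by (rule poly_mapping_eqI) (auto simp: lookup_sum lookup_single when_def in_keys_iff)

lemma poly_eval_mult: "poly_eval x (p * q) = poly_eval x p * poly_eval x q"
proof -
  let ?s = "\<lambda>p m. Poly_Mapping.single m (Poly_Mapping.lookup p m) :: mpoly"
  have "poly_eval x (p * q) =
      poly_eval x ((\<Sum>m\<in>Poly_Mapping.keys p. ?s p m) * (\<Sum>m\<in>Poly_Mapping.keys q. ?s q m))"
    using sum_monomials[of p] sum_monomials[of q] by simp
  also have "\<dots> = (\<Sum>m\<in>Poly_Mapping.keys p. \<Sum>m'\<in>Poly_Mapping.keys q.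
      (Poly_Mapping.lookup p m * mon_eval x m) * (Poly_Mapping.lookup q m' * mon_eval x m'))"
    by (simp add: sum_product mult_single mpf.linear_sum[OF functional_poly_eval]
        poly_eval_single mon_eval_add mult_ac)
  also have "\<dots> = poly_eval x p * poly_eval x q"
    by (simp add: poly_eval_def sum_product)
  finally show ?thesis .
qed

lemma poly_eval_power: "poly_eval x (p ^ d) = poly_eval x p ^ d"
proof (induction d)
  case 0
  have "poly_eval x 1 = 1"
    using poly_eval_single[of x 0 1] by (simp add: mon_eval_def)
  then show ?case by simp
qed (simp add: poly_eval_mult)

section \<open>Linear forms and polarization of quartic relations\<close>

abbreviation Var :: "nat \<Rightarrow> mpoly" where
  "Var i \<equiv> Poly_Mapping.single (Poly_Mapping.single i (Suc 0)) 1"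

lemma single_pscale: "Poly_Mapping.single m c = pscale c (Poly_Mapping.single m 1)"
  by (simp add: pscale_conv_mult mult_single)

lemma subspace_forms: "mp.subspace (forms d n)"
proof (rule mp.subspaceI)
  fix x y assume "x \<in> forms d n" "y \<in> forms d n"
  then show "x + y \<in> forms d n"
    using keys_add[of x y] unfolding forms_def by blast
next
  fix c x assume "x \<in> forms d n"
  moreover have "Poly_Mapping.keys (pscale c x) \<subseteq> Poly_Mapping.keys x"
    by (auto simp: in_keys_iff lookup_pscale)
  ultimately show "pscale c x \<in> forms d n"
    unfolding forms_def by blast
qed (simp add: forms_def)

lemma Var_in_forms: "i \<le> n \<Longrightarrow> Var i \<in> forms 1 n"
  by (simp add: forms_def)

lemma linear_form_monomial:
  assumes "z \<in> forms 1 n" "m \<in> Poly_Mapping.keys z"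
  obtains i where "i \<le> n" "m = Poly_Mapping.single i 1"
proof -
  have k: "Poly_Mapping.keys m \<subseteq> {..n}" "(\<Sum>i \<in> Poly_Mapping.keys m. Poly_Mapping.lookup m i) = 1"
    using assms unfolding forms_def by blast+
  then obtain i where i: "i \<in> Poly_Mapping.keys m" "Poly_Mapping.lookup m i = 1"
      and 0: "\<And>j. j \<in> Poly_Mapping.keys m \<Longrightarrow> j \<noteq> i \<Longrightarrow> Poly_Mapping.lookup m j = 0"
    using sum_eq_1_iff[OF finite_keys, THEN iffD1, OF k(2)] by metis
  have "m = Poly_Mapping.single i 1"
    by (rule poly_mapping_eqI) (metis i 0 in_keys_iff lookup_single_eq lookup_single_not_eq)
  with i k that show ?thesis by blast
qed

lemma forms_1_span: "forms 1 n = mp.span (Var ` {..n})"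
proof
  show "mp.span (Var ` {..n}) \<subseteq> forms 1 n"
    by (rule mp.span_minimal[OF _ subspace_forms]) (intro image_subsetI Var_in_forms, simp)
  show "forms 1 n \<subseteq> mp.span (Var ` {..n})"
  proof
    fix z assume z: "z \<in> forms 1 n"
    have "(\<Sum>m\<in>Poly_Mapping.keys z. Poly_Mapping.single m (Poly_Mapping.lookup z m)) \<in> mp.span (Var ` {..n})"
    proof (rule mp.span_sum)
      fix m assume "m \<in> Poly_Mapping.keys z"
      with z obtain i where "i \<le> n" "m = Poly_Mapping.single i 1" by (rule linear_form_monomial)
      then show "Poly_Mapping.single m (Poly_Mapping.lookup z m) \<in> mp.span (Var ` {..n})"
        by (subst single_pscale) (auto intro: mp.span_scale mp.span_base)
    qed
    then show "z \<in> mp.span (Var ` {..n})" using sum_monomials[of z] by simp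
  qed
qed

text \<open>Both sides are linear and agree on the variables. Hence a functional on linear forms
  extends to a ring homomorphism, evaluation at the point \<open>\<lambda>i. h (Var i)\<close>,
  which can be applied to powers.\<close>

lemma poly_eval_linear_form:
  assumes "functional h" "z \<in> forms 1 n"
  shows "poly_eval (\<lambda>i. h (Var i)) z = h z"
proof (rule mpf.linear_eq_on[OF functional_poly_eval assms(1)])
  show "z \<in> mp.span (Var ` {..n})" using assms(2) forms_1_span by simp
  show "poly_eval (\<lambda>i. h (Var i)) b = h b" if "b \<in> Var ` {..n}" for b
    using that by (auto simp: poly_eval_single mon_eval_def)
qed

lemma functional_add_diff:
  assumes "functional g" "functional h"
  shows "functional (\<lambda>x. g x + h x)" "functional (\<lambda>x. g x - h x)"
  using assms by (simp_all add: mpf.linear_compose_add mpf.linear_compose_sub)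

text \<open>Evaluation homomorphisms give the relation for the fourth power of a single functional;
  polarization then recovers products of four. In this form a relation between fourth powers can be
  contracted with functionals.\<close>

lemma polarization:
  assumes "finite Z" "Z \<subseteq> forms 1 n" "(\<Sum>z\<in>Z. pscale (c z) (z ^ 4)) = 0"
    and h: "functional h1" "functional h2" "functional h3" "functional h4"
  shows "(\<Sum>z\<in>Z. c z * (h1 z * h2 z * h3 z * h4 z)) = 0"
proof -
  have Q: "(\<Sum>z\<in>Z. c z * h z ^ 4) = 0" if "functional h" for h
  proof -
    let ?E = "poly_eval (\<lambda>i. h (Var i))"
    have "0 = ?E (\<Sum>z\<in>Z. pscale (c z) (z ^ 4))"
      using assms(3) by (simp add: mpf.linear_0[OF functional_poly_eval])
    also have "\<dots> = (\<Sum>z\<in>Z. c z * h z ^ 4)"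
      using assms(2) poly_eval_linear_form[OF that]
      by (simp add: functional_simps[OF functional_poly_eval] poly_eval_power)
         (intro sum.cong, auto)
    finally show ?thesis by simp
  qed
  \<comment> \<open>The polarization identity with the sign of \<open>h1\<close> fixed: eight sign
    patterns, each weighted by the product of its signs, and the constant is 8 times 4!.\<close>
  have eq: "192 * (c z * (h1 z * h2 z * h3 z * h4 z)) =
      c z * (h1 z + h2 z + h3 z + h4 z) ^ 4 - c z * (h1 z + h2 z + h3 z - h4 z) ^ 4
      - c z * (h1 z + h2 z - h3 z + h4 z) ^ 4 - c z * (h1 z - h2 z + h3 z + h4 z) ^ 4
      + c z * (h1 z + h2 z - h3 z - h4 z) ^ 4 + c z * (h1 z - h2 z + h3 z - h4 z) ^ 4
      + c z * (h1 z - h2 z - h3 z + h4 z) ^ 4 - c z * (h1 z - h2 z - h3 z - h4 z) ^ 4" for z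
    by algebra
  have "192 * (\<Sum>z\<in>Z. c z * (h1 z * h2 z * h3 z * h4 z)) = 0"
    unfolding sum_distrib_left eq sum.distrib sum_subtractf
    by (simp add: Q functional_add_diff h)
  then show ?thesis by simp
qed

subsection \<open>Points in linear general position\<close>

lemma sum_fun_apply: "(\<Sum>i\<in>I. f i) x = (\<Sum>i\<in>I. f i x)" for f :: "'i \<Rightarrow> 'b \<Rightarrow> complex"
  by (induction I rule: infinite_finite_induct) simp_all

lemma functional_separates:
  assumes "mp.independent S" "s \<in> S"
  obtains h where "functional h" "h s = 1" "\<And>x. x \<in> S - {s} \<Longrightarrow> h x = 0"
proof -
  obtain h where "functional h" "\<forall>x\<in>S. h x = (if x = s then 1 else 0)"
    using mpf.linear_independent_extend[OF assms(1), of "\<lambda>x. if x = s then 1 else 0"] by blast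
  with assms(2) that show thesis by auto
qed

lemma functional_nonzero:
  assumes "v \<noteq> 0"
  obtains h where "functional h" "h v = 1"
  using functional_separates[of "{v}" v] assms by auto

lemma functional_span_0:
  assumes "functional h" "\<And>x. x \<in> S \<Longrightarrow> h x = 0" "v \<in> mp.span S"
  shows "h v = 0"
  using mpf.linear_eq_0_on_span[OF assms(1)] assms(2,3) by blast

interpretation fn: vector_space "\<lambda>(c::complex) f x. c * f x"
  by unfold_locales (auto simp: algebra_simps fun_eq_iff)

declare fn.scale_scale [simp del]

text \<open>The tensor \<open>v \<otimes> v\<close>, encoded by its values on pairs of functionals.
  The default 0 on all other pairs keeps them from influencing equalities and spans.\<close>

definition square_tensor :: "mpoly \<Rightarrow> (mpoly \<Rightarrow> complex) \<times> (mpoly \<Rightarrow> complex) \<Rightarrow> complex" where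
  "square_tensor v = (\<lambda>(h, k). if functional h \<and> functional k then h v * k v else 0)"

text \<open>\<open>A\<close> now holds vectors, one for each point. The bound in
  \<open>indep\<close> is \<open>n + 1\<close> because this is the minimum of
  \<open>2 * n + 1\<close> and \<open>n + 1\<close>.\<close>

locale general_position =
  fixes n :: nat and A :: "mpoly set"
  assumes A_forms: "A \<subseteq> forms 1 n" and card_A: "card A = 2 * n + 1"
    and indep: "\<And>S. S \<subseteq> A \<Longrightarrow> card S \<le> n + 1 \<Longrightarrow> mp.independent S"
begin

lemma finite_A: "finite A"
  using card_A by (metis Suc_eq_plus1 card.infinite nat.distinct(1))

lemma subset_finite: "P \<subseteq> A \<Longrightarrow> finite P"
  using finite_A finite_subset by blast

lemma card_compl:
  assumes "P \<subseteq> A" "card P = n"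
  shows "card (A - P) = n + 1"
  using assms card_A by (simp add: card_Diff_subset subset_finite)

lemma span_basis:
  assumes "Q \<subseteq> A" "card Q = n + 1"
  shows "mp.span Q = forms 1 n"
proof
  show "mp.span Q \<subseteq> forms 1 n"
    using assms(1) A_forms by (intro mp.span_minimal subspace_forms) blast
  have "card (Var ` {..n}) \<le> n + 1"
    using card_image_le[of "{..n}" Var] by simp
  then show "forms 1 n \<subseteq> mp.span Q"
    unfolding forms_1_span
    using assms A_forms[unfolded forms_1_span] by (intro mp.independent_spanning indep) auto
qed

text \<open>With any further \<open>a\<close>, the set \<open>P\<close> becomes a basis of the
  linear forms, so a functional vanishing on both would be zero there, against the witness
  \<open>x\<close>. Geometrically, the hyperplane through \<open>n\<close> of the points contains no
  other point of \<open>A\<close>.\<close>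

lemma vanishing_exactly:
  assumes "P \<subseteq> A" "card P = n" "functional h" "\<And>a. a \<in> P \<Longrightarrow> h a = 0"
    and "x \<in> forms 1 n" "h x \<noteq> 0" "a \<in> A - P"
  shows "h a \<noteq> 0"
proof
  assume "h a = 0"
  moreover have "x \<in> mp.span (insert a P)"
    using assms span_basis[of "insert a P"] by (simp add: subset_finite)
  ultimately have "h x = 0"
    using functional_span_0[OF assms(3), of "insert a P" x] assms(4) by blast
  with assms(6) show False by contradiction
qed

lemma vanishing_functional:
  assumes "P \<subseteq> A" "card P = n"
  obtains h where "functional h" "\<And>a. a \<in> P \<Longrightarrow> h a = 0" "\<And>a. a \<in> A - P \<Longrightarrow> h a \<noteq> 0"
proof -
  have "A - P \<noteq> {}" using card_compl[OF assms] by (metis Suc_eq_plus1 card.empty nat.distinct(1))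
  then obtain a where a: "a \<in> A" "a \<notin> P" by blast
  have "mp.independent (insert a P)"
    using a assms by (intro indep) (auto simp: subset_finite)
  then obtain h where "functional h" "h a = 1" "\<And>x. x \<in> insert a P - {a} \<Longrightarrow> h x = 0"
    using functional_separates by blast
  with a show thesis
    using A_forms vanishing_exactly[OF assms, of h a] by (intro that[of h]) auto
qed

text \<open>\<open>square_relation b N\<close> says \<open>b \<otimes> b = (\<Sum>a\<in>A. N a (a \<otimes> a))\<close>.\<close>

definition square_relation :: "mpoly \<Rightarrow> (mpoly \<Rightarrow> complex) \<Rightarrow> bool" where
  "square_relation b N \<longleftrightarrow> (\<forall>h k. functional h \<longrightarrow> functional k \<longrightarrow>
     h b * k b = (\<Sum>a\<in>A. N a * (h a * k a)))"

lemma square_relationD: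
  "square_relation b N \<Longrightarrow> functional h \<Longrightarrow> functional k \<Longrightarrow>
     h b * k b = (\<Sum>a\<in>A. N a * (h a * k a))"
  unfolding square_relation_def by blast

text \<open>The case \<open>c = 0\<close> also excludes the zero vector, since \<open>A\<close> is
  nonempty.\<close>

definition new_point :: "mpoly \<Rightarrow> bool" where
  "new_point b \<longleftrightarrow> b \<in> forms 1 n \<and> (\<forall>a\<in>A. \<forall>c. b \<noteq> pscale c a)"

lemma new_point_nonzero: "new_point b \<Longrightarrow> b \<noteq> 0"
  using card_A unfolding new_point_def by (metis add_is_0 card.empty equals0I mp.scale_zero_left zero_neq_one)

lemma contraction:
  assumes "square_relation b N" "functional h"
  shows "pscale (h b) b = (\<Sum>a\<in>A. pscale (N a * h a) a)"
  by (rule functional_eqI)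
     (use square_relationD[OF assms] in \<open>simp add: functional_simps mult.assoc\<close>)

text \<open>If \<open>h b = 0\<close>, contracting with \<open>h\<close> leaves a linear relation
  among the \<open>n + 1\<close> independent vectors of \<open>A - P\<close>, which kills
  \<open>N\<close> there. The coefficients on \<open>P\<close> then vanish because \<open>b\<close>
  is no multiple of a point of \<open>A\<close>, and \<open>b \<otimes> b = 0\<close>
  results.\<close>

lemma nonvanishing:
  assumes b: "new_point b" "square_relation b N"
    and P: "P \<subseteq> A" "card P = n"
    and h: "functional h" "\<And>a. a \<in> P \<Longrightarrow> h a = 0" "x \<in> forms 1 n" "h x \<noteq> 0"
  shows "h b \<noteq> 0"
proof
  assume 0: "h b = 0"
  have "(\<Sum>a\<in>A - P. pscale (N a * h a) a) = (\<Sum>a\<in>A. pscale (N a * h a) a)"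
    using P(1) h(2) finite_A by (intro sum.mono_neutral_left) auto
  also have "\<dots> = 0"
    using contraction[OF b(2) h(1)] 0 by simp
  finally have "N a * h a = 0" if "a \<in> A - P" for a
    using mp.independentD[of "A - P" "A - P" "\<lambda>a. N a * h a" a] that finite_A card_compl[OF P]
    by (simp add: indep)
  then have N1: "N a = 0" if "a \<in> A - P" for a
    using that vanishing_exactly[OF P h(1,2,3,4)] by auto
  have N2: "N a = 0" if a: "a \<in> P" for a
  proof -
    have "mp.independent P" using P by (intro indep) auto
    with a obtain k where k: "functional k" "k a = 1" "\<And>x. x \<in> P - {a} \<Longrightarrow> k x = 0"
      using functional_separates by blast
    have "pscale (k b) b = (\<Sum>x\<in>A. if x = a then pscale (N a) a else 0)"
      unfolding contraction[OF b(2) k(1)] using N1 k(2,3)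
      by (intro sum.cong) auto
    also have "\<dots> = pscale (N a) a" using a P(1) finite_A by auto
    finally have eq: "pscale (k b) b = pscale (N a) a" .
    have "k b = 0"
    proof (rule ccontr)
      assume "k b \<noteq> 0"
      then have "b = pscale (N a / k b) a"
        using arg_cong[OF eq, of "pscale (1 / k b)"] by simp
      with b(1) a P(1) show False unfolding new_point_def by blast
    qed
    with eq have "N a = 0 \<or> a = 0" by simp
    moreover have "a \<noteq> 0" using \<open>mp.independent P\<close> a mp.dependent_zero by blast
    ultimately show ?thesis by blast
  qed
  have "N a = 0" if "a \<in> A" for a using N1 N2 that by blast
  then have "k b * k b = 0" if "functional k" for k
    using square_relationD[OF b(2) that that] by simp
  moreover obtain k where "functional k" "k b = 1"
    using functional_nonzero[OF new_point_nonzero[OF b(1)]] by blast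
  ultimately show False by fastforce
qed

lemma split_at:
  assumes "a \<in> A"
  obtains P Q where "P \<subseteq> A" "card P = n" "Q \<subseteq> A" "card Q = n" "A = insert a (P \<union> Q)"
    "a \<notin> P" "a \<notin> Q" "P \<inter> Q = {}"
proof -
  have c: "card (A - {a}) = 2 * n" using assms card_A finite_A by simp
  then obtain P where P: "P \<subseteq> A - {a}" "card P = n" "finite P"
    using obtain_subset_with_card_n[of n "A - {a}"] by auto
  show thesis
  proof (rule that[of P "A - {a} - P"])
    show "card (A - {a} - P) = n"
      using P c by (simp add: card_Diff_subset)
  qed (use P assms in auto)
qed

text \<open>Split \<open>A - {a}\<close> into two halves of size \<open>n\<close> and take the
  hyperplane through each. On their product the relation retains only the term of \<open>a\<close>,
  while neither functional vanishes at \<open>b\<close>.\<close>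

lemma coefficient_nonzero:
  assumes b: "new_point b" "square_relation b N" and a: "a \<in> A"
  shows "N a \<noteq> 0"
proof
  assume 0: "N a = 0"
  obtain P Q where PQ: "P \<subseteq> A" "card P = n" "Q \<subseteq> A" "card Q = n" "A = insert a (P \<union> Q)"
    "a \<notin> P" "a \<notin> Q" using split_at[OF a] by metis
  obtain h where h: "functional h" "\<And>a. a \<in> P \<Longrightarrow> h a = 0" "\<And>a. a \<in> A - P \<Longrightarrow> h a \<noteq> 0"
    using vanishing_functional[OF PQ(1,2)] by blast
  obtain k where k: "functional k" "\<And>a. a \<in> Q \<Longrightarrow> k a = 0" "\<And>a. a \<in> A - Q \<Longrightarrow> k a \<noteq> 0"
    using vanishing_functional[OF PQ(3,4)] by blast
  have "a \<in> forms 1 n" using a A_forms by blast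
  moreover have "h a \<noteq> 0" "k a \<noteq> 0" using h k a PQ by auto
  ultimately have "h b \<noteq> 0" "k b \<noteq> 0"
    using nonvanishing[OF b PQ(1,2) h(1,2)] nonvanishing[OF b PQ(3,4) k(1,2)] by auto
  moreover have "N x * (h x * k x) = 0" if "x \<in> A" for x
    using that 0 h(2) k(2) PQ(5) by auto
  then have "h b * k b = 0"
    unfolding square_relationD[OF b(2) h(1) k(1)] by (simp add: sum.neutral)
  ultimately show False by simp
qed

text \<open>The hyperplanes through the two halves of \<open>A - {a}\<close> form a quadric that
  misses only \<open>a\<close> among the points of \<open>A\<close>. By \<open>nonvanishing\<close>
  it also misses every new point with a square relation.\<close>

lemma separating_product:
  assumes a: "a \<in> A"
  obtains h k where "functional h" "functional k" "h a * k a \<noteq> 0"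
    "\<And>x. x \<in> A - {a} \<Longrightarrow> h x * k x = 0"
    "\<And>b N. new_point b \<Longrightarrow> square_relation b N \<Longrightarrow> h b * k b \<noteq> 0"
proof -
  obtain P Q where PQ: "P \<subseteq> A" "card P = n" "Q \<subseteq> A" "card Q = n" "A = insert a (P \<union> Q)"
    "a \<notin> P" "a \<notin> Q" using split_at[OF a] by metis
  obtain h where h: "functional h" "\<And>a. a \<in> P \<Longrightarrow> h a = 0" "\<And>a. a \<in> A - P \<Longrightarrow> h a \<noteq> 0"
    using vanishing_functional[OF PQ(1,2)] by blast
  obtain k where k: "functional k" "\<And>a. a \<in> Q \<Longrightarrow> k a = 0" "\<And>a. a \<in> A - Q \<Longrightarrow> k a \<noteq> 0"
    using vanishing_functional[OF PQ(3,4)] by blast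
  have f: "a \<in> forms 1 n" using a A_forms by blast
  have nz: "h a \<noteq> 0" "k a \<noteq> 0" using h k a PQ by auto
  show thesis
  proof (rule that[of h k])
    show "h x * k x = 0" if "x \<in> A - {a}" for x
      using that h(2) k(2) PQ(5) by auto
    show "h b * k b \<noteq> 0" if b: "new_point b" "square_relation b N" for b N
      using nonvanishing[OF b PQ(1,2) h(1,2) f nz(1)] nonvanishing[OF b PQ(3,4) k(1,2) f nz(2)]
      by simp
  qed (use h k nz in auto)
qed

text \<open>Contracting with a separating product leaves only the term of \<open>a\<close>, so that
  \<open>b \<otimes> b\<close>, and after one more contraction \<open>b\<close> itself, becomes a
  multiple of \<open>a\<close>.\<close>

lemma no_quartic_relation:
  assumes b: "new_point b" "square_relation b N"
    and q: "\<And>h1 h2 h3 h4. functional h1 \<Longrightarrow> functional h2 \<Longrightarrow> functional h3 \<Longrightarrow> functional h4 \<Longrightarrow>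
      h1 b * h2 b * h3 b * h4 b = (\<Sum>a\<in>A. c a * (h1 a * h2 a * h3 a * h4 a))"
  shows False
proof -
  obtain a where a: "a \<in> A" using card_A by fastforce
  obtain h k where hk: "functional h" "functional k" "\<And>x. x \<in> A - {a} \<Longrightarrow> h x * k x = 0"
    "h b * k b \<noteq> 0"
    using separating_product[OF a] b by metis
  obtain g where g: "functional g" "g b = 1"
    using functional_nonzero[OF new_point_nonzero[OF b(1)]] by blast
  have "b = pscale (c a * h a * k a * g a / (h b * k b)) a"
  proof (rule functional_eqI)
    fix f assume f: "functional f"
    have "h b * k b * g b * f b = (\<Sum>x\<in>A. c x * (h x * k x * g x * f x))"
      by (rule q) (use hk g f in auto)
    also have "\<dots> = (\<Sum>x\<in>A. if x = a then c a * (h a * k a * g a * f a) else 0)"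
      using hk(3) by (intro sum.cong) auto
    also have "\<dots> = c a * (h a * k a * g a * f a)" using a finite_A by simp
    finally show "f b = f (pscale (c a * h a * k a * g a / (h b * k b)) a)"
      using hk(4) g(2) by (simp add: functional_simps[OF f] field_simps)
  qed
  with b(1) a show False unfolding new_point_def by blast
qed

text \<open>The tensors \<open>a \<otimes> a\<close> are independent, and contracting the quartic
  identity with separating products puts each of them in the span of the tensors from
  \<open>B\<close>. As \<open>B\<close> has at most \<open>2 * n + 1\<close> elements, the two spans
  are equal.\<close>

lemma square_relations:
  assumes B: "finite B" "card B \<le> 2 * n + 1"
    and \<alpha>: "\<And>a. a \<in> A \<Longrightarrow> \<alpha> a \<noteq> 0"
    and q: "\<And>h1 h2 h3 h4. functional h1 \<Longrightarrow> functional h2 \<Longrightarrow> functional h3 \<Longrightarrow> functional h4 \<Longrightarrow>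
      (\<Sum>a\<in>A. \<alpha> a * (h1 a * h2 a * h3 a * h4 a)) = (\<Sum>b\<in>B. \<beta> b * (h1 b * h2 b * h3 b * h4 b))"
  shows "card B = 2 * n + 1" "\<And>b. b \<in> B \<Longrightarrow> \<exists>N. square_relation b N"
proof -
  let ?t = square_tensor
  have scalars: "f a = 0" if "(\<Sum>a\<in>A. (\<lambda>x. f a * ?t a x)) = 0" and a: "a \<in> A" for f a
  proof -
    obtain h k where hk: "functional h" "functional k" "h a * k a \<noteq> 0"
      "\<And>x. x \<in> A - {a} \<Longrightarrow> h x * k x = 0"
      using separating_product[OF a] by metis
    have "0 = (\<Sum>x\<in>A. f x * (h x * k x))"
      using fun_cong[OF that(1), of "(h, k)"] hk(1,2)
      by (simp add: sum_fun_apply square_tensor_def)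
    also have "\<dots> = (\<Sum>x\<in>A. if x = a then f a * (h a * k a) else 0)"
      using hk(4) by (intro sum.cong) auto
    also have "\<dots> = f a * (h a * k a)" using a finite_A by simp
    finally show ?thesis using hk(3) by simp
  qed
  have inj: "inj_on ?t A"
  proof (rule inj_onI, rule ccontr)
    fix a a' assume a: "a \<in> A" "a' \<in> A" "?t a = ?t a'" "a \<noteq> a'"
    obtain h k where hk: "functional h" "functional k" "h a * k a \<noteq> 0"
      "\<And>x. x \<in> A - {a} \<Longrightarrow> h x * k x = 0"
      using separating_product[OF a(1)] by metis
    show False
      using fun_cong[OF a(3), of "(h, k)"] hk a by (auto simp: square_tensor_def)
  qed
  have ind: "fn.independent (?t ` A)"
  proof (rule fn.independent_if_scalars_zero)
    fix f v assume *: "(\<Sum>x\<in>?t ` A. (\<lambda>xa. f x * x xa)) = 0" "v \<in> ?t ` A"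
    then show "f v = 0"
      using scalars[of "\<lambda>a. f (?t a)"] by (auto simp: sum.reindex[OF inj])
  qed (simp add: finite_A)
  have sub: "?t ` A \<subseteq> fn.span (?t ` B)"
  proof
    fix v assume "v \<in> ?t ` A"
    then obtain a where a: "a \<in> A" "v = ?t a" by blast
    obtain h k where hk: "functional h" "functional k" "h a * k a \<noteq> 0"
      "\<And>x. x \<in> A - {a} \<Longrightarrow> h x * k x = 0"
      using separating_product[OF a(1)] by metis
    \<comment> \<open>Contraction with \<open>h\<close> and \<open>k\<close> leaves
      \<open>\<alpha> a * (h a * k a)\<close> times \<open>a \<otimes> a\<close> on the side of
      \<open>A\<close>; this factor is nonzero and is divided out.\<close>
    have "v = (\<Sum>b\<in>B. (\<lambda>x. \<beta> b * (h b * k b) / (\<alpha> a * (h a * k a)) * ?t b x))"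
    proof
      fix x :: "(mpoly \<Rightarrow> complex) \<times> (mpoly \<Rightarrow> complex)"
      obtain f g where x: "x = (f, g)" by fastforce
      show "v x = (\<Sum>b\<in>B. (\<lambda>x. \<beta> b * (h b * k b) / (\<alpha> a * (h a * k a)) * ?t b x)) x"
      proof (cases "functional f \<and> functional g")
        case True
        have "(\<Sum>b\<in>B. \<beta> b * (h b * k b * f b * g b)) = (\<Sum>x\<in>A. \<alpha> x * (h x * k x * f x * g x))"
          using q hk True by simp
        also have "\<dots> = (\<Sum>x\<in>A. if x = a then \<alpha> a * (h a * k a * f a * g a) else 0)"
          using hk(4) by (intro sum.cong) auto
        also have "\<dots> = \<alpha> a * (h a * k a) * (f a * g a)" using a finite_A by (simp add: mult_ac)
        finally have "f a * g a = (\<Sum>b\<in>B. \<beta> b * (h b * k b * f b * g b)) / (\<alpha> a * (h a * k a))"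
          using hk(3) \<alpha>[OF a(1)] by simp
        then show ?thesis
          using True by (simp add: a x square_tensor_def sum_fun_apply sum_divide_distrib mult_ac)
      qed (auto simp: a x square_tensor_def sum_fun_apply)
    qed
    also have "\<dots> \<in> fn.span (?t ` B)"
      by (intro fn.span_sum fn.span_scale fn.span_base imageI)
    finally show "v \<in> fn.span (?t ` B)" .
  qed
  have "card (?t ` A) \<le> card (?t ` B)"
    using fn.independent_span_bound[OF _ ind sub] B(1) by blast
  then have card: "2 * n + 1 \<le> card (?t ` B)"
    by (simp add: card_image[OF inj] card_A)
  then show "card B = 2 * n + 1"
    using card_image_le[OF B(1), of ?t] B(2) by simp
  \<comment> \<open>The tensors from \<open>A\<close> are at least as many as those from
    \<open>B\<close>, so being independent they span the larger space too.\<close>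
  have sub': "fn.span (?t ` B) \<subseteq> fn.span (?t ` A)"
    using B card_image_le[OF B(1), of ?t]
    by (intro fn.independent_spanning ind sub) (auto simp: card_image[OF inj] card_A)
  show "\<exists>N. square_relation b N" if "b \<in> B" for b
  proof -
    have "?t b \<in> fn.span (?t ` A)" using that sub' fn.span_base by blast
    then obtain u where u: "?t b = (\<Sum>v\<in>?t ` A. (\<lambda>x. u v * v x))"
      using fn.span_finite[of "?t ` A"] finite_A by auto
    then have u': "?t b = (\<Sum>a\<in>A. (\<lambda>x. u (?t a) * ?t a x))"
      by (simp add: sum.reindex[OF inj])
    have "square_relation b (\<lambda>a. u (?t a))"
      unfolding square_relation_def
    proof (intro allI impI)
      fix h k assume "functional h" "functional k"
      then show "h b * k b = (\<Sum>a\<in>A. u (?t a) * (h a * k a))"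
        using fun_cong[OF u', of "(h, k)"]
        by (simp add: sum_fun_apply square_tensor_def)
    qed
    then show ?thesis by blast
  qed
qed

end

section \<open>Coordinates in a basis chosen among the points\<close>

locale based_general_position = general_position +
  fixes E :: "mpoly set" and \<epsilon> :: "mpoly \<Rightarrow> mpoly \<Rightarrow> complex"
  assumes E: "E \<subseteq> A" "card E = n + 1"
    and \<epsilon>: "\<And>e. e \<in> E \<Longrightarrow> functional (\<epsilon> e)" "\<And>e. e \<in> E \<Longrightarrow> \<epsilon> e e = 1"
      "\<And>e f. e \<in> E \<Longrightarrow> f \<in> E \<Longrightarrow> f \<noteq> e \<Longrightarrow> \<epsilon> e f = 0"
begin

lemma finite_E: "finite E" using E(1) by (rule subset_finite)

lemma E_forms: "E \<subseteq> forms 1 n" using E(1) A_forms by blast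

lemma card_C: "card (A - E) = n"
  using E card_A by (simp add: card_Diff_subset subset_finite)

lemma coordinates_expansion:
  assumes "x \<in> forms 1 n"
  shows "x = (\<Sum>e\<in>E. pscale (\<epsilon> e x) e)"
proof -
  have "x \<in> mp.span E" using assms span_basis[OF E] by blast
  then obtain u where u: "x = (\<Sum>e\<in>E. pscale (u e) e)"
    using mp.span_finite[OF finite_E] by auto
  have "\<epsilon> e x = u e" if "e \<in> E" for e
  proof -
    have "\<epsilon> e x = (\<Sum>f\<in>E. if f = e then u e else 0)"
      unfolding u functional_simps[OF \<epsilon>(1)[OF that]] using that \<epsilon>(2,3)
      by (intro sum.cong) auto
    then show ?thesis using that finite_E by simp
  qed
  then show ?thesis by (subst u) (intro sum.cong, auto)
qed

text \<open>The coordinate hyperplane of \<open>e\<close> passes through the \<open>n\<close> other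
  basis points. These facts are premises of \<open>vanishing_exactly\<close> and
  \<open>nonvanishing\<close>, with \<open>e\<close> as the witness that the functional is
  nonzero.\<close>

lemma facet:
  assumes "e \<in> E"
  shows "E - {e} \<subseteq> A" "card (E - {e}) = n" "\<And>a. a \<in> E - {e} \<Longrightarrow> \<epsilon> e a = 0" "e \<in> forms 1 n"
  using assms E \<epsilon>(3) A_forms finite_E by auto

lemma coordinate_nonzero:
  assumes "new_point b" "square_relation b N" "e \<in> E"
  shows "\<epsilon> e b \<noteq> 0"
  using nonvanishing[OF assms(1,2) facet(1,2)[OF assms(3)] \<epsilon>(1)[OF assms(3)] facet(3,4)[OF assms(3)]]
    \<epsilon>(2) assms(3) by simp

lemma coordinate_nonzero_C:
  assumes "c \<in> A - E" "e \<in> E"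
  shows "\<epsilon> e c \<noteq> 0"
  using vanishing_exactly[OF facet(1,2)[OF assms(2)] \<epsilon>(1)[OF assms(2)] facet(3,4)[OF assms(2)]]
    \<epsilon>(2) assms by auto

lemma relation_complement:
  assumes "square_relation b N" "functional h" "functional k"
    and "\<And>x. x \<in> A - S \<Longrightarrow> h x * k x = 0" "S \<subseteq> A"
  shows "h b * k b = (\<Sum>x\<in>S. N x * (h x * k x))"
  unfolding square_relationD[OF assms(1-3)] using assms(4,5) finite_A
  by (intro sum.mono_neutral_right) auto

text \<open>
  The coordinatewise inverse is the Cremona transformation that contracts the rational normal
  curves through \<open>E\<close> to lines. Collinearity is obtained by applying both square relations to a
  coordinate function \<open>\<epsilon> e\<close> and to functionals vanishing on all of \<open>A - E\<close>, or on \<open>b\<close> and all of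
  \<open>A - E\<close> but \<open>c\<close>, and eliminating the contribution of \<open>e\<close>.
\<close>

lemma inverse_collinear:
  assumes b: "new_point b" "square_relation b N"
    and b': "new_point b'" "square_relation b' N'"
    and neq: "\<And>c. b' \<noteq> pscale c b"
    and c: "c \<in> A - E"
  obtains p q where "p \<noteq> 0" "q \<noteq> 0"
    "\<And>e. e \<in> E \<Longrightarrow> 1 / \<epsilon> e c = p / \<epsilon> e b + q / \<epsilon> e b'"
proof -
  let ?C = "A - E"
  have C: "?C \<subseteq> A" by blast
  obtain g where g: "functional g" "\<And>a. a \<in> ?C \<Longrightarrow> g a = 0" "\<And>a. a \<in> A - ?C \<Longrightarrow> g a \<noteq> 0"
    using vanishing_functional[OF C card_C] by blast
  obtain e0 where e0: "e0 \<in> E" using E(2) by fastforce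
  with E(1) have "g e0 \<noteq> 0" using g(3) by blast
  with e0 have gb: "g b \<noteq> 0" "g b' \<noteq> 0"
    using nonvanishing[OF b C card_C g(1,2)] nonvanishing[OF b' C card_C g(1,2)] E_forms by auto
  \<comment> \<open>\<open>g\<close> vanishes on this span but not at \<open>b\<close>; the
    independence that follows provides \<open>k\<close>.\<close>
  have "b \<notin> mp.span ?C"
    using functional_span_0[OF g(1,2)] gb(1) by blast
  moreover have "mp.independent ?C" using card_C by (intro indep) auto
  ultimately have "mp.independent (insert b ?C)" by (rule mp.independent_insertI)
  with c obtain k where k: "functional k" "k c = 1" "\<And>x. x \<in> insert b ?C - {c} \<Longrightarrow> k x = 0"
    using functional_separates[of "insert b ?C" c] by blast
  have "b \<noteq> c" using b(1) c unfolding new_point_def by (metis Diff_iff mp.scale_one)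
  then have kb: "k b = 0" using k(3) by blast
  have N: "N a \<noteq> 0" "N' a \<noteq> 0" if "a \<in> A" for a
    using coefficient_nonzero b b' that by auto
  have eb: "\<epsilon> e b \<noteq> 0" "\<epsilon> e b' \<noteq> 0" "\<epsilon> e c \<noteq> 0" if "e \<in> E" for e
    using coordinate_nonzero coordinate_nonzero_C b b' c that by auto
  have relg: "\<epsilon> e x * g x = M e * g e" if "square_relation x M" and e: "e \<in> E" for x M e
  proof -
    have "\<epsilon> e x * g x = (\<Sum>a\<in>{e}. M a * (\<epsilon> e a * g a))"
      using g(2) \<epsilon>(3) e E(1)
      by (intro relation_complement[OF that(1) \<epsilon>(1)[OF e] g(1)]) auto
    then show ?thesis using \<epsilon>(2)[OF e] by simp
  qed
  have relk: "\<epsilon> e x * k x = M e * k e + M c * \<epsilon> e c" if "square_relation x M" and e: "e \<in> E" for x M e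
  proof -
    have "\<epsilon> e x * k x = (\<Sum>a\<in>{e, c}. M a * (\<epsilon> e a * k a))"
      using k(3) \<epsilon>(3) e E(1) c
      by (intro relation_complement[OF that(1) \<epsilon>(1)[OF e] k(1)]) auto
    also have "\<dots> = M e * k e + M c * \<epsilon> e c"
      using \<epsilon>(2)[OF e] k(2) e c by (subst sum.insert) auto
    finally show ?thesis .
  qed
  \<comment> \<open>\<open>I\<close> eliminates \<open>g e\<close> and \<open>II\<close> eliminates
    \<open>k e\<close> between the relations for \<open>b\<close> and \<open>b'\<close>;
    \<open>II\<close> also uses \<open>k b = 0\<close>.\<close>
  have I: "N' e * \<epsilon> e b * g b = N e * \<epsilon> e b' * g b'" if "e \<in> E" for e
    using relg[OF b(2) that] relg[OF b'(2) that] by algebra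
  have II: "N e * \<epsilon> e b' * k b' = \<epsilon> e c * (N e * N' c - N' e * N c)" if "e \<in> E" for e
    using relk[OF b(2) that] relk[OF b'(2) that] kb by algebra
  \<comment> \<open>Otherwise \<open>I\<close> and \<open>II\<close> give all coordinates of
    \<open>b\<close> and \<open>b'\<close> the same ratio, which contradicts
    \<open>neq\<close>.\<close>
  have kb': "k b' \<noteq> 0"
  proof
    assume 0: "k b' = 0"
    have "\<epsilon> e b' = N' c / N c * g b / g b' * \<epsilon> e b" if e: "e \<in> E" for e
    proof -
      have "N e * N' c = N' e * N c" using II[OF e] 0 eb(3)[OF e] by simp
      then have "N e * (N' c * \<epsilon> e b * g b) = N e * (N c * \<epsilon> e b' * g b')"
        using I[OF e] by algebra
      then have "N' c * \<epsilon> e b * g b = N c * \<epsilon> e b' * g b'"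
        using N(1)[of e] E(1) e by auto
      then show ?thesis using N(1)[of c] c gb by (simp add: field_simps)
    qed
    then have "b' = pscale (N' c / N c * g b / g b') b"
      using coordinates_expansion[of b] coordinates_expansion[of b'] b(1) b'(1)
      unfolding new_point_def
      by (smt (verit) mp.scale_scale mp.scale_sum_right sum.cong)
    with neq show False by blast
  qed
  \<comment> \<open>The two coefficients come from dividing identity \<open>1\<close> below by
    \<open>N e\<close>, by \<open>k b' * g b\<close> and by the coordinates; they do not depend on
    \<open>e\<close>.\<close>
  show thesis
  proof (rule that[of "- (N c * g b' / (k b' * g b))" "N' c / k b'"])
    fix e assume e: "e \<in> E"
    then have Ne: "N e \<noteq> 0" using N E(1) by blast
    have 1: "N e * k b' * g b * \<epsilon> e b * \<epsilon> e b' =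
        \<epsilon> e c * (N e * N' c * g b * \<epsilon> e b - N e * N c * g b' * \<epsilon> e b')"
      using I[OF e] II[OF e] by algebra
    then have "N e * (k b' * g b * \<epsilon> e b * \<epsilon> e b') =
        N e * (\<epsilon> e c * (N' c * g b * \<epsilon> e b - N c * g b' * \<epsilon> e b'))"
      by algebra
    then have "k b' * g b * \<epsilon> e b * \<epsilon> e b' =
        \<epsilon> e c * (N' c * g b * \<epsilon> e b - N c * g b' * \<epsilon> e b')"
      using Ne by simp
    then show "1 / \<epsilon> e c = - (N c * g b' / (k b' * g b)) / \<epsilon> e b + N' c / k b' / \<epsilon> e b'"
      using eb[OF e] gb kb' by (simp add: field_simps)
  qed (use N c gb kb' in auto)
qed

text \<open>If the coordinates \<open>e\<close> and \<open>f\<close> had the same ratio at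
  \<open>b\<close> and \<open>b'\<close>, then by \<open>inverse_collinear\<close> also at every
  point of \<open>A - E\<close>. A functional would then vanish at \<open>b\<close> and on
  \<open>A - E\<close> but not at \<open>e\<close>, against \<open>nonvanishing\<close>. This makes
  the parameters of the basis points on the curve distinct.\<close>

lemma coordinates_not_proportional:
  assumes b: "new_point b" "square_relation b N"
    and b': "new_point b'" "square_relation b' N'"
    and neq: "\<And>c. b' \<noteq> pscale c b"
    and e: "e \<in> E" "f \<in> E" "e \<noteq> f"
  shows "\<epsilon> e b * \<epsilon> f b' \<noteq> \<epsilon> f b * \<epsilon> e b'"
proof
  assume eq: "\<epsilon> e b * \<epsilon> f b' = \<epsilon> f b * \<epsilon> e b'"
  define h where "h = (\<lambda>x. \<epsilon> f b' * \<epsilon> e x - \<epsilon> e b' * \<epsilon> f x)"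
  have h: "functional h"
    unfolding h_def by (intro functionalI)
      (simp_all add: functional_simps[OF \<epsilon>(1)[OF e(1)]] functional_simps[OF \<epsilon>(1)[OF e(2)]] algebra_simps)
  have nz: "\<epsilon> e b \<noteq> 0" "\<epsilon> f b \<noteq> 0" "\<epsilon> e b' \<noteq> 0" "\<epsilon> f b' \<noteq> 0"
    using coordinate_nonzero b b' e by auto
  have "h c = 0" if c: "c \<in> A - E" for c
  proof -
    obtain p q where pq: "\<And>e. e \<in> E \<Longrightarrow> 1 / \<epsilon> e c = p / \<epsilon> e b + q / \<epsilon> e b'"
      using inverse_collinear[OF b b' neq c] by metis
    have nzc: "\<epsilon> e c \<noteq> 0" "\<epsilon> f c \<noteq> 0" using coordinate_nonzero_C c e by auto
    have "\<epsilon> e b * \<epsilon> e b' = \<epsilon> e c * (p * \<epsilon> e b' + q * \<epsilon> e b)"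
      using pq[OF e(1)] nz nzc by (simp add: field_simps)
    moreover have "\<epsilon> f b * \<epsilon> f b' = \<epsilon> f c * (p * \<epsilon> f b' + q * \<epsilon> f b)"
      using pq[OF e(2)] nz nzc by (simp add: field_simps)
    ultimately have "\<epsilon> e b * \<epsilon> e b' * \<epsilon> f c * (p * \<epsilon> f b' + q * \<epsilon> f b) =
       \<epsilon> f b * \<epsilon> f b' * \<epsilon> e c * (p * \<epsilon> e b' + q * \<epsilon> e b)" by algebra
    then have "1 / \<epsilon> f c * \<epsilon> f b' = 1 / \<epsilon> e c * \<epsilon> e b'"
      unfolding pq[OF e(1)] pq[OF e(2)] using eq nz by (simp add: field_simps)
    then show ?thesis
      unfolding h_def using nzc by (simp add: field_simps)
  qed
  moreover have "h e \<noteq> 0"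
    unfolding h_def using nz \<epsilon>(2)[OF e(1)] \<epsilon>(3)[of f e] e by simp
  ultimately have "h b \<noteq> 0"
    using nonvanishing[OF b _ card_C h, of e] E_forms e(1) by blast
  with eq show False by (simp add: h_def mult.commute)
qed

end

subsection \<open>Rational normal curves with prescribed basis points\<close>

definition binary_exponent :: "nat \<Rightarrow> nat \<Rightarrow> nat \<Rightarrow>\<^sub>0 nat" where
  "binary_exponent n k = Poly_Mapping.single 0 k + Poly_Mapping.single 1 (n - k)"

lemma binary_exponent_inject: "binary_exponent n k = binary_exponent n l \<longleftrightarrow> k = l"
proof
  assume "binary_exponent n k = binary_exponent n l"
  from arg_cong[OF this, of "\<lambda>m. Poly_Mapping.lookup m 0"] show "k = l"
    by (simp add: binary_exponent_def lookup_add lookup_single)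
qed simp

lemma single_power: "pscale c (Var i) ^ k = Poly_Mapping.single (Poly_Mapping.single i k) (c ^ k)"
proof (induction k)
  case (Suc k)
  have "Poly_Mapping.single i (Suc 0) + Poly_Mapping.single i k = Poly_Mapping.single i (Suc k)"
    by (simp flip: single_add)
  with Suc show ?case by (simp add: mult_single flip: single_pscale)
qed simp

lemma binary_power:
  "(pscale u (Var 0) + pscale v (Var 1)) ^ n =
     (\<Sum>k\<le>n. Poly_Mapping.single (binary_exponent n k) (of_nat (n choose k) * u ^ k * v ^ (n - k)))"
proof -
  have "of_nat (n choose k) * pscale u (Var 0) ^ k * pscale v (Var 1) ^ (n - k) =
    Poly_Mapping.single (binary_exponent n k) (of_nat (n choose k) * u ^ k * v ^ (n - k))" for k
    by (simp add: single_power mult_single binary_exponent_def flip: single_of_nat)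
  then show ?thesis by (simp add: binomial_ring)
qed

lemma lookup_binary_power:
  assumes "k \<le> n"
  shows "Poly_Mapping.lookup ((pscale u (Var 0) + pscale v (Var 1)) ^ n) (binary_exponent n k) =
     of_nat (n choose k) * u ^ k * v ^ (n - k)"
  using assms by (simp del: One_nat_def add: binary_power lookup_sum lookup_single binary_exponent_inject when_def)

lemma forms_binary_span:
  "forms n 1 = mp.span ((\<lambda>k. Poly_Mapping.single (binary_exponent n k) 1) ` {..n})"
    (is "_ = mp.span ?X")
proof
  show "mp.span ?X \<subseteq> forms n 1"
  proof (rule mp.span_minimal[OF _ subspace_forms], rule image_subsetI)
    fix k assume "k \<in> {..n}"
    moreover have "Poly_Mapping.keys (binary_exponent n k) \<subseteq> {0, 1}"
      using keys_add[of "Poly_Mapping.single 0 k" "Poly_Mapping.single 1 (n - k)"]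
      unfolding binary_exponent_def by (auto simp del: One_nat_def split: if_splits)
    moreover from this have "(\<Sum>i\<in>Poly_Mapping.keys (binary_exponent n k).
        Poly_Mapping.lookup (binary_exponent n k) i) =
        (\<Sum>i\<in>{0, 1}. Poly_Mapping.lookup (binary_exponent n k) i)"
      by (intro sum.mono_neutral_left) (auto simp: in_keys_iff)
    ultimately show "Poly_Mapping.single (binary_exponent n k) 1 \<in> forms n 1"
      by (auto simp: forms_def binary_exponent_def lookup_add lookup_single)
  qed
  show "forms n 1 \<subseteq> mp.span ?X"
  proof
    fix z assume z: "z \<in> forms n 1"
    have "(\<Sum>m\<in>Poly_Mapping.keys z. Poly_Mapping.single m (Poly_Mapping.lookup z m)) \<in> mp.span ?X"
    proof (rule mp.span_sum)
      fix m assume "m \<in> Poly_Mapping.keys z"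
      with z have m: "Poly_Mapping.keys m \<subseteq> {..1}"
        "(\<Sum>i \<in> Poly_Mapping.keys m. Poly_Mapping.lookup m i) = n"
        unfolding forms_def by blast+
      have "(\<Sum>i \<in> Poly_Mapping.keys m. Poly_Mapping.lookup m i) = (\<Sum>i\<le>1. Poly_Mapping.lookup m i)"
        using m(1) by (intro sum.mono_neutral_left) (auto simp: in_keys_iff)
      then have s: "Poly_Mapping.lookup m 0 + Poly_Mapping.lookup m 1 = n"
        using m(2) by simp
      have "m = binary_exponent n (Poly_Mapping.lookup m 0)"
      proof (rule poly_mapping_eqI)
        fix i
        have "i > 1 \<Longrightarrow> Poly_Mapping.lookup m i = 0"
          using m(1) by (metis atMost_iff in_keys_iff linorder_not_le subsetD)
        then show "Poly_Mapping.lookup m i =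
            Poly_Mapping.lookup (binary_exponent n (Poly_Mapping.lookup m 0)) i"
          using s by (cases "i = 0"; cases "i = 1")
            (auto simp: binary_exponent_def lookup_add lookup_single when_def)
      qed
      then have "Poly_Mapping.single m 1 \<in> ?X" using s by (metis (lifting) atMost_iff image_eqI le_add1)
      then show "Poly_Mapping.single m (Poly_Mapping.lookup z m) \<in> mp.span ?X"
        by (subst single_pscale) (intro mp.span_scale mp.span_base)
    qed
    then show "z \<in> mp.span ?X" using sum_monomials[of z] by simp
  qed
qed

text \<open>A redundant vector of \<open>S\<close> could be dropped, leaving the independent set
  \<open>E\<close> in the span of fewer than \<open>card E\<close> vectors.\<close>

lemma minimal_spanning_independent:
  assumes "finite S" "mp.independent E" "E \<subseteq> mp.span S" "card S \<le> card E"
  shows "mp.independent S"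
proof
  assume "mp.dependent S"
  then obtain a where a: "a \<in> S" "a \<in> mp.span (S - {a})" unfolding mp.dependent_def by blast
  have "mp.span (insert a (S - {a})) = mp.span (S - {a})" using a(2) by (rule mp.span_redundant)
  then have "E \<subseteq> mp.span (S - {a})" using assms(3) a(1) by (simp add: insert_absorb)
  then have "card E \<le> card (S - {a})"
    using mp.independent_span_bound[OF _ assms(2)] assms(1) by simp
  moreover have "card (S - {a}) < card S" using assms(1) a(1) by (rule card_Diff1_less)
  ultimately show False using assms(4) by simp
qed

text \<open>The image of \<open>S\<close> has at most \<open>card E\<close> vectors and its span
  contains the independent set \<open>E\<close>, so it is independent itself and
  \<open>\<phi>\<close> is injective on \<open>S\<close>. Bijectivity thus follows from surjectivity
  by counting.\<close>

lemma linear_spanning_bij_betw: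
  assumes \<phi>: "Vector_Spaces.linear pscale pscale \<phi>" and S: "finite S" "card S \<le> card E"
    and E: "mp.independent E" "E \<subseteq> \<phi> ` mp.span S" "\<phi> ` mp.span S \<subseteq> mp.span E"
  shows "bij_betw \<phi> (mp.span S) (mp.span E)"
proof -
  have im: "\<phi> ` mp.span S = mp.span (\<phi> ` S)"
    using mpp.linear_span_image[OF \<phi>, of S] by simp
  have c: "card (\<phi> ` S) \<le> card S" using S(1) by (rule card_image_le)
  have ind: "mp.independent (\<phi> ` S)"
    using finite_imageI[OF S(1)] E(1) E(2)[unfolded im] le_trans[OF c S(2)]
    by (rule minimal_spanning_independent)
  have "card E \<le> card (\<phi> ` S)"
    using mp.independent_span_bound[of "\<phi> ` S" E] E im S(1) by simp
  then have inj: "inj_on \<phi> S"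
    using S c by (intro eq_card_imp_inj_on) auto
  have "inj_on \<phi> (mp.span S)"
    using mpp.linear_inj_on_span_independent_image[OF \<phi> ind inj] .
  moreover have "mp.span E \<subseteq> \<phi> ` mp.span S"
    unfolding im using E(2) unfolding im by (rule mp.span_minimal) (rule mp.subspace_span)
  ultimately show ?thesis using E(3) unfolding bij_betw_def by blast
qed

text \<open>Expanding the product chooses a subset \<open>B\<close> of factors contributing
  \<open>u\<close>; grouping by \<open>card B\<close> collects the powers. The coefficients must not
  depend on \<open>u\<close> and \<open>v\<close>, hence the order of quantifiers.\<close>

lemma binary_product_expansion:
  fixes \<beta> \<gamma> :: "'a \<Rightarrow> complex"
  assumes "finite J"
  shows "\<exists>g. \<forall>u v. (\<Prod>f\<in>J. u * \<beta> f + v * \<gamma> f) = (\<Sum>k\<le>card J. g k * u ^ k * v ^ (card J - k))"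
proof (intro exI allI)
  fix u v
  let ?h = "\<lambda>B. prod \<beta> B * prod \<gamma> (J - B)"
  have "(\<Prod>f\<in>J. u * \<beta> f + v * \<gamma> f) = (\<Sum>B\<in>Pow J. ?h B * u ^ card B * v ^ (card J - card B))"
    unfolding prod_add[OF assms]
    by (intro sum.cong) (auto simp: prod.distrib card_Diff_subset finite_subset[OF _ assms] mult_ac)
  also have "\<dots> = (\<Sum>k\<le>card J. \<Sum>B | B \<in> Pow J \<and> card B = k. ?h B * u ^ card B * v ^ (card J - card B))"
    by (rule sum.group[symmetric]) (use assms in \<open>auto intro: card_mono\<close>)
  also have "\<dots> = (\<Sum>k\<le>card J. (\<Sum>B | B \<in> Pow J \<and> card B = k. ?h B) * u ^ k * v ^ (card J - k))"
    by (simp add: sum_distrib_right)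
  finally show "(\<Prod>f\<in>J. u * \<beta> f + v * \<gamma> f) =
    (\<Sum>k\<le>card J. (\<Sum>B | B \<in> Pow J \<and> card B = k. ?h B) * u ^ k * v ^ (card J - k))" .
qed

lemma image_proj_point:
  assumes "Vector_Spaces.linear pscale pscale \<phi>"
  shows "\<phi> ` proj_point v = proj_point (\<phi> v)"
  using mpp.linear_span_image[OF assms, of "{v}"] unfolding proj_point_def by simp

lemma binary_linear_form:
  assumes "(p, q) \<noteq> (0, 0)"
  shows "proj_point (pscale p (Var 0) + pscale q (Var 1)) \<in> Pn 1"
proof -
  let ?L = "pscale p (Var 0) + pscale q (Var 1)"
  have "?L \<in> forms 1 1"
    unfolding forms_1_span by (intro mp.span_add mp.span_scale mp.span_base) auto
  moreover have "Poly_Mapping.single 0 (Suc 0) \<noteq> Poly_Mapping.single (Suc 0) (Suc 0)"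
    by (metis lookup_single_eq lookup_single_not_eq nat.distinct(1))
  then have "Poly_Mapping.lookup ?L (Poly_Mapping.single 0 (Suc 0)) = p"
    "Poly_Mapping.lookup ?L (Poly_Mapping.single 1 (Suc 0)) = q"
    by (simp_all add: lookup_add lookup_pscale lookup_single when_def)
  then have "?L \<noteq> 0" using assms by force
  ultimately show ?thesis unfolding Pn_def proj_def by blast
qed

text \<open>Up to a common factor the products are the coordinatewise inverses of the points of the
  line spanned by \<open>\<beta>\<close> and \<open>\<gamma>\<close>, but they stay defined where a
  coordinate vanishes. They are \<open>n + 1\<close> binary forms of degree \<open>n\<close>,
  independent because \<open>distinct\<close> gives their factors different roots.\<close>

lemma rational_normal_curve_through:
  fixes \<beta> \<gamma> :: "mpoly \<Rightarrow> complex"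
  assumes E: "mp.independent E" "mp.span E = forms 1 n" "card E = n + 1"
    and distinct: "\<And>e f. e \<in> E \<Longrightarrow> f \<in> E \<Longrightarrow> e \<noteq> f \<Longrightarrow> \<beta> e * \<gamma> f \<noteq> \<beta> f * \<gamma> e"
  obtains C where "rational_normal_curve n C"
    "\<And>p q. (p, q) \<noteq> (0, 0) \<Longrightarrow>
      proj_point (\<Sum>e\<in>E. pscale (\<Prod>f\<in>E - {e}. p * \<beta> f + q * \<gamma> f) e) \<in> C"
proof -
  have finE: "finite E" using E(3) by (metis Suc_eq_plus1 card.infinite nat.distinct(1))
  define G where "G = (\<lambda>p q e. \<Prod>f\<in>E - {e}. p * \<beta> f + q * \<gamma> f)"
  have "\<exists>g. \<forall>p q. G p q e = (\<Sum>k\<le>n. g k * p ^ k * q ^ (n - k))" if "e \<in> E" for e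
  proof -
    have "card (E - {e}) = n" using that E(3) finE by simp
    then show ?thesis
      using binary_product_expansion[of "E - {e}" \<beta> \<gamma>] finE unfolding G_def by simp
  qed
  then obtain g where g: "\<And>p q e. e \<in> E \<Longrightarrow> G p q e = (\<Sum>k\<le>n. g e k * p ^ k * q ^ (n - k))"
    by metis
  \<comment> \<open>Dividing by the binomial coefficients of \<open>L p q ^ n\<close> below makes \<open>\<phi> (L p q ^ n)\<close> the given point.\<close>
  define \<phi> where "\<phi> = (\<lambda>P. \<Sum>e\<in>E. pscale (\<Sum>k\<le>n. g e k / of_nat (n choose k) *
      Poly_Mapping.lookup P (binary_exponent n k)) e)"
  have lin: "Vector_Spaces.linear pscale pscale \<phi>"
    by (rule Vector_Spaces.linear.intro[OF mp.vector_space_axioms mp.vector_space_axioms], unfold_locales)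
      (simp_all add: \<phi>_def lookup_add lookup_pscale ring_distribs add_divide_distrib sum.distrib mp.scale_left_distrib
        mp.scale_sum_right sum_distrib_left mult_ac)
  define L where "L = (\<lambda>p q. pscale p (Var 0) + pscale q (Var 1))"
  have \<phi>L: "\<phi> (L p q ^ n) = (\<Sum>e\<in>E. pscale (G p q e) e)" for p q
    unfolding \<phi>_def L_def using g
    by (intro sum.cong arg_cong2[of _ _ _ _ pscale])
      (auto simp del: One_nat_def simp: lookup_binary_power mult.assoc intro!: sum.cong)
  let ?X = "(\<lambda>k. Poly_Mapping.single (binary_exponent n k) 1 :: mpoly) ` {..n}"
  have L_forms: "L p q ^ n \<in> mp.span ?X" for p q
    unfolding L_def binary_power
    by (subst single_pscale) (intro mp.span_sum mp.span_scale mp.span_base imageI)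
  have "bij_betw \<phi> (mp.span ?X) (mp.span E)"
  proof (rule linear_spanning_bij_betw[OF lin _ _ E(1)])
    show "card ?X \<le> card E" using card_image_le[of "{..n}"] E(3) by (metis Suc_eq_plus1 card_atMost finite_atMost)
    show "E \<subseteq> \<phi> ` mp.span ?X"
    proof
      fix e assume e: "e \<in> E"
      \<comment> \<open>At the root of the factor indexed by \<open>e\<close>, every product except
        that of \<open>e\<close> vanishes, so this parameter is sent to a multiple of
        \<open>e\<close>.\<close>
      let ?P = "L (\<gamma> e) (- \<beta> e) ^ n" and ?c = "G (\<gamma> e) (- \<beta> e) e"
      have "\<phi> ?P = (\<Sum>f\<in>E. if f = e then pscale ?c e else 0)"
        unfolding \<phi>L using finE e by (intro sum.cong) (auto simp: G_def mult.commute)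
      then have "\<phi> ?P = pscale ?c e" using e finE by simp
      moreover have "?c \<noteq> 0"
        using distinct[OF e] finE by (fastforce simp: G_def mult.commute)
      ultimately have "e = \<phi> (pscale (1 / ?c) ?P)"
        by (simp add: mpp.linear_scale[OF lin])
      then show "e \<in> \<phi> ` mp.span ?X" using L_forms mp.span_scale by blast
    qed
    show "\<phi> ` mp.span ?X \<subseteq> mp.span E"
      unfolding \<phi>_def by (auto intro!: mp.span_sum mp.span_scale intro: mp.span_base)
  qed simp
  then have bij: "bij_betw \<phi> (forms n 1) (forms 1 n)"
    by (simp only: forms_binary_span E(2))
  show thesis
  proof (rule that)
    show "rational_normal_curve n ((\<lambda>x. \<phi> ` veronese n x) ` Pn 1)"
      unfolding rational_normal_curve_def using lin bij by blast
    show "proj_point (\<Sum>e\<in>E. pscale (\<Prod>f\<in>E - {e}. p * \<beta> f + q * \<gamma> f) e)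
        \<in> (\<lambda>x. \<phi> ` veronese n x) ` Pn 1" if "(p, q) \<noteq> (0, 0)" for p q
      using binary_linear_form[OF that] \<phi>L[of p q]
      by (intro image_eqI[of _ _ "proj_point (L p q)"])
        (simp_all add: veronese_proj_point image_proj_point[OF lin] G_def L_def)
  qed
qed

lemma proj_point_pscale:
  assumes "c \<noteq> 0"
  shows "proj_point (pscale c v) = proj_point v"
proof -
  have "v = pscale (1 / c) (pscale c v)" using assms by simp
  then have "v \<in> mp.span {pscale c v}" by (metis mp.span_base mp.span_scale singletonI)
  moreover have "pscale c v \<in> mp.span {v}" by (simp add: mp.span_base mp.span_scale)
  ultimately show ?thesis
    unfolding proj_point_def by (intro subset_antisym mp.span_minimal) (auto simp: mp.subspace_span)
qed

lemma proj_point_self: "v \<in> proj_point v"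
  unfolding proj_point_def by (simp add: mp.span_base)

section \<open>The curve through all the points\<close>

context based_general_position
begin

text \<open>Multiplying all inverse coordinates gives \<open>\<kappa>\<close>, and omitting the one
  of \<open>e\<close> gives \<open>\<kappa> * \<epsilon> e x\<close>. The curve point with parameter
  \<open>(p, q)\<close> is therefore that of \<open>pscale \<kappa> x\<close>.\<close>

lemma inverse_on_curve:
  assumes x: "x \<in> forms 1 n" "\<And>e. e \<in> E \<Longrightarrow> 1 / \<epsilon> e x = p * \<beta> e + q * \<gamma> e"
    "\<And>e. e \<in> E \<Longrightarrow> \<epsilon> e x \<noteq> 0"
    and C: "\<And>p q. (p, q) \<noteq> (0, 0) \<Longrightarrow>
      proj_point (\<Sum>e\<in>E. pscale (\<Prod>f\<in>E - {e}. p * \<beta> f + q * \<gamma> f) e) \<in> C"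
  shows "proj_point x \<in> C"
proof -
  obtain e0 where e0: "e0 \<in> E" using E(2) by fastforce
  have "(p, q) \<noteq> (0, 0)" using x(2,3)[OF e0] by auto
  then have on: "proj_point (\<Sum>e\<in>E. pscale (\<Prod>f\<in>E - {e}. p * \<beta> f + q * \<gamma> f) e) \<in> C"
    by (rule C)
  define \<kappa> where "\<kappa> = (\<Prod>e\<in>E. 1 / \<epsilon> e x)"
  have "(\<Sum>e\<in>E. pscale (\<Prod>f\<in>E - {e}. p * \<beta> f + q * \<gamma> f) e) = (\<Sum>e\<in>E. pscale (\<kappa> * \<epsilon> e x) e)"
  proof (intro sum.cong arg_cong2[of _ _ _ _ pscale] refl)
    fix e assume e: "e \<in> E"
    have "\<kappa> = 1 / \<epsilon> e x * (\<Prod>f\<in>E - {e}. 1 / \<epsilon> f x)"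
      unfolding \<kappa>_def using finite_E e by (rule prod.remove)
    then have "\<kappa> * \<epsilon> e x = (\<Prod>f\<in>E - {e}. 1 / \<epsilon> f x)"
      using x(3)[OF e] by simp
    also have "\<dots> = (\<Prod>f\<in>E - {e}. p * \<beta> f + q * \<gamma> f)"
      by (intro prod.cong) (auto simp: x(2))
    finally show "(\<Prod>f\<in>E - {e}. p * \<beta> f + q * \<gamma> f) = \<kappa> * \<epsilon> e x" by simp
  qed
  also have "\<dots> = pscale \<kappa> x"
    by (subst (2) coordinates_expansion[OF x(1)]) (simp add: mp.scale_sum_right)
  finally have "proj_point (pscale \<kappa> x) \<in> C"
    using on by simp
  moreover have "\<kappa> \<noteq> 0" unfolding \<kappa>_def using x(3) finite_E by simp
  ultimately show ?thesis by (simp add: proj_point_pscale)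
qed

text \<open>The line through the inverses of \<open>b\<close> and \<open>b'\<close> fixes the curve.
  Basis points lie on it at the roots of the factors, points of \<open>A - E\<close> by
  \<open>inverse_collinear\<close>, and the rest of \<open>W\<close> by comparing two such lines at
  one point of \<open>A - E\<close>.\<close>

lemma curve_through:
  assumes n: "n \<ge> 1"
    and W: "\<And>b. b \<in> W \<Longrightarrow> new_point b" "\<And>b. b \<in> W \<Longrightarrow> \<exists>N. square_relation b N"
      "\<And>b b' c. b \<in> W \<Longrightarrow> b' \<in> W \<Longrightarrow> b \<noteq> b' \<Longrightarrow> b' \<noteq> pscale c b"
    and bb': "b \<in> W" "b' \<in> W" "b \<noteq> b'"
  obtains C where "rational_normal_curve n C" "\<And>x. x \<in> A \<union> W \<Longrightarrow> proj_point x \<in> C"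
proof -
  obtain N N' where N: "square_relation b N" "square_relation b' N'"
    using W(2) bb' by metis
  note b = W(1)[OF bb'(1)] N(1) and b' = W(1)[OF bb'(2)] N(2)
  define \<beta> \<gamma> where "\<beta> = (\<lambda>e. 1 / \<epsilon> e b)" and "\<gamma> = (\<lambda>e. 1 / \<epsilon> e b')"
  have nz: "\<epsilon> e x \<noteq> 0" if "x \<in> W" "e \<in> E" for e x
    using coordinate_nonzero W(1,2) that by metis
  have dist: "\<beta> e * \<gamma> f \<noteq> \<beta> f * \<gamma> e" if "e \<in> E" "f \<in> E" "e \<noteq> f" for e f
    using coordinates_not_proportional[OF b b' W(3)[OF bb'] that] nz bb' that
    unfolding \<beta>_def \<gamma>_def by (auto simp: field_simps)
  have "mp.independent E" using E by (intro indep) auto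
  then obtain C where C: "rational_normal_curve n C"
    "\<And>p q. (p, q) \<noteq> (0, 0) \<Longrightarrow>
      proj_point (\<Sum>e\<in>E. pscale (\<Prod>f\<in>E - {e}. p * \<beta> f + q * \<gamma> f) e) \<in> C"
    using rational_normal_curve_through[OF _ span_basis[OF E] E(2), of \<beta> \<gamma>] dist by blast
  have on_E: "proj_point e \<in> C" if e: "e \<in> E" for e
  proof -
    \<comment> \<open>The parameter \<open>(\<gamma> e, - \<beta> e)\<close> annihilates the factor
      of \<open>e\<close>, which occurs in every product but its own.\<close>
    let ?G = "\<lambda>g. \<Prod>f\<in>E - {g}. \<gamma> e * \<beta> f + - \<beta> e * \<gamma> f"
    have "(\<Sum>g\<in>E. pscale (?G g) g) = (\<Sum>g\<in>E. if g = e then pscale (?G e) e else 0)"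
      using finite_E e by (intro sum.cong) (auto simp: mult.commute)
    also have "\<dots> = pscale (?G e) e" using e finite_E by simp
    finally have eq: "(\<Sum>g\<in>E. pscale (?G g) g) = pscale (?G e) e" .
    have "?G e \<noteq> 0"
      using dist[OF e] finite_E by (fastforce simp: mult.commute)
    moreover have "\<gamma> e \<noteq> 0" using nz bb' e by (simp add: \<gamma>_def)
    then have "proj_point (pscale (?G e) e) \<in> C"
      unfolding eq[symmetric] by (intro C(2)) simp
    ultimately show ?thesis by (simp add: proj_point_pscale)
  qed
  have on_C: "proj_point c \<in> C" if c: "c \<in> A - E" for c
  proof -
    obtain p q where "\<And>e. e \<in> E \<Longrightarrow> 1 / \<epsilon> e c = p / \<epsilon> e b + q / \<epsilon> e b'"
      using inverse_collinear[OF b b' W(3)[OF bb'] c] by metis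
    then show ?thesis
      using coordinate_nonzero_C[OF c] c A_forms
      by (intro inverse_on_curve[of c p \<beta> q \<gamma>, OF _ _ _ C(2)]) (auto simp: \<beta>_def \<gamma>_def)
  qed
  \<comment> \<open>Since \<open>n \<ge> 1\<close> there is a point outside the basis; it serves as
    pivot for the points of \<open>W\<close>.\<close>
  have "A - E \<noteq> {}" using card_C n by (metis card.empty not_one_le_zero)
  then obtain c where c: "c \<in> A - E" by blast
  have on_W: "proj_point x \<in> C" if x: "x \<in> W" for x
  proof (cases "x = b")
    case True
    then show ?thesis
      using nz[OF x] W(1)[OF x]
      by (intro inverse_on_curve[of x 1 \<beta> 0 \<gamma>, OF _ _ _ C(2)]) (auto simp: \<beta>_def new_point_def)
  next
    case False
    obtain M where M: "square_relation x M" using W(2)[OF x] by blast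
    obtain p q where 1: "\<And>e. e \<in> E \<Longrightarrow> 1 / \<epsilon> e c = p / \<epsilon> e b + q / \<epsilon> e b'"
      using inverse_collinear[OF b b' W(3)[OF bb'] c] by metis
    \<comment> \<open>Both relations express the inverse of the same \<open>c\<close>, so it can be
      eliminated; \<open>q' \<noteq> 0\<close> allows solving for the inverse of
      \<open>x\<close>.\<close>
    obtain p' q' where 2: "q' \<noteq> 0" "\<And>e. e \<in> E \<Longrightarrow> 1 / \<epsilon> e c = p' / \<epsilon> e b + q' / \<epsilon> e x"
      using inverse_collinear[OF b W(1)[OF x] M W(3)[OF bb'(1) x False[symmetric]] c] by metis
    have "1 / \<epsilon> e x = (p - p') / q' * \<beta> e + q / q' * \<gamma> e" if "e \<in> E" for e
    proof -
      have "q' * (1 / \<epsilon> e x) = (p - p') * \<beta> e + q * \<gamma> e"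
        using 1[OF that] 2(2)[OF that] unfolding \<beta>_def \<gamma>_def divide_inverse by algebra
      then have "1 / \<epsilon> e x = ((p - p') * \<beta> e + q * \<gamma> e) / q'"
        using 2(1) by (metis nonzero_mult_div_cancel_left)
      then show ?thesis by (simp add: add_divide_distrib)
    qed
    then show ?thesis
      using nz[OF x] W(1)[OF x]
      by (intro inverse_on_curve[of x "(p - p') / q'" \<beta> "q / q'" \<gamma>, OF _ _ _ C(2)]) (auto simp: new_point_def)
  qed
  show thesis
    using that[OF C(1)] on_E on_C on_W by blast
qed

end

lemma (in general_position) based_general_position:
  obtains E \<epsilon> where "based_general_position n A E \<epsilon>"
proof -
  obtain E where E: "E \<subseteq> A" "card E = n + 1"
    using obtain_subset_with_card_n[of "n + 1" A] card_A by auto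
  then have "mp.independent E" by (intro indep) auto
  then have "\<forall>e\<in>E. \<exists>h. functional h \<and> h e = 1 \<and> (\<forall>f\<in>E. f \<noteq> e \<longrightarrow> h f = 0)"
    using functional_separates by (metis (no_types, lifting) DiffI singletonD)
  then obtain \<epsilon> where "\<forall>e\<in>E. functional (\<epsilon> e) \<and> \<epsilon> e e = 1 \<and> (\<forall>f\<in>E. f \<noteq> e \<longrightarrow> \<epsilon> e f = 0)"
    by metis
  then show thesis
    using E by (intro that[of E \<epsilon>] based_general_position.intro general_position_axioms
      based_general_position_axioms.intro) auto
qed

subsection \<open>Minimal representations\<close>

text \<open>The sum runs over \<open>X\<close> and not over the image, so that coefficients belong
  to points even where \<open>f\<close> identifies some of them.\<close>

lemma span_image_sum:
  assumes "finite X" "v \<in> mp.span (f ` X)"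
  shows "\<exists>\<alpha>. v = (\<Sum>x\<in>X. pscale (\<alpha> x) (f x))"
  using assms
proof (induction X arbitrary: v rule: finite_induct)
  case (insert a F)
  then obtain k where "v - pscale k (f a) \<in> mp.span (f ` F)"
    by (auto simp: mp.span_breakdown_eq)
  then obtain \<alpha> where \<alpha>: "v - pscale k (f a) = (\<Sum>x\<in>F. pscale (\<alpha> x) (f x))"
    using insert.IH by blast
  have "(\<Sum>x\<in>F. pscale ((\<alpha>(a := k)) x) (f x)) = (\<Sum>x\<in>F. pscale (\<alpha> x) (f x))"
    using insert.hyps by (intro sum.cong) auto
  then have "v = (\<Sum>x\<in>insert a F. pscale ((\<alpha>(a := k)) x) (f x))"
    using insert.hyps \<alpha> by (simp add: algebra_simps)
  then show ?case by blast
qed simp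

text \<open>Each \<open>veronese d x\<close> is the line through \<open>r x ^ d\<close>, so both
  sides concern the same subspace. This passes from projective points to vectors.\<close>

lemma proj_point_in_proj_span_veronese:
  assumes "T \<noteq> 0" "\<And>x. x \<in> X \<Longrightarrow> x = proj_point (r x)"
  shows "proj_point T \<in> proj_span (veronese d ` X) \<longleftrightarrow> T \<in> mp.span ((\<lambda>x. r x ^ d) ` X)"
proof -
  have v: "veronese d x = proj_point (r x ^ d)" if "x \<in> X" for x
    using assms(2)[OF that] veronese_proj_point by metis
  have "mp.span (\<Union>(veronese d ` X)) = mp.span ((\<lambda>x. r x ^ d) ` X)"
  proof (intro subset_antisym mp.span_minimal mp.subspace_span)
    show "\<Union>(veronese d ` X) \<subseteq> mp.span ((\<lambda>x. r x ^ d) ` X)"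
    proof (rule Union_least)
      fix y assume "y \<in> veronese d ` X"
      then obtain x where "x \<in> X" "y = mp.span {r x ^ d}" using v unfolding proj_point_def by blast
      then show "y \<subseteq> mp.span ((\<lambda>x. r x ^ d) ` X)" by (simp add: mp.span_mono)
    qed
    show "(\<lambda>x. r x ^ d) ` X \<subseteq> mp.span (\<Union>(veronese d ` X))"
      using v proj_point_self by (fastforce intro: mp.span_base)
  qed
  moreover have "T \<in> mp.span S" if "proj_point T = proj_point w" "w \<in> mp.span S" for w S
    using that proj_point_self[of T] mp.span_minimal[of "{w}" "mp.span S"] mp.subspace_span
    unfolding proj_point_def by blast
  ultimately show ?thesis
    using assms(1) unfolding proj_span_def proj_def by auto
qed

text \<open>A zero coefficient would let its point be dropped, against minimality.\<close>

lemma minimal_representation: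
  assumes "T \<noteq> 0" "computes n X T" "minimal_for X T" "\<And>x. x \<in> X \<Longrightarrow> x = proj_point (r x)"
  obtains \<alpha> where "T = (\<Sum>x\<in>X. pscale (\<alpha> x) (r x ^ 4))" "\<And>x. x \<in> X \<Longrightarrow> \<alpha> x \<noteq> 0"
proof -
  note iff = proj_point_in_proj_span_veronese[OF assms(1)]
  have X: "finite X" "T \<in> mp.span ((\<lambda>x. r x ^ 4) ` X)"
    using assms(2) iff[of X r 4] assms(4) unfolding computes_def by auto
  then obtain \<alpha> where \<alpha>: "T = (\<Sum>x\<in>X. pscale (\<alpha> x) (r x ^ 4))"
    using span_image_sum[OF X] by blast
  have "\<alpha> x \<noteq> 0" if x: "x \<in> X" for x
  proof
    assume "\<alpha> x = 0"
    then have "T = (\<Sum>y\<in>X - {x}. pscale (\<alpha> y) (r y ^ 4))"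
      using \<alpha> X(1) x by (simp add: sum.remove)
    also have "\<dots> \<in> mp.span ((\<lambda>x. r x ^ 4) ` (X - {x}))"
      by (intro mp.span_sum mp.span_scale mp.span_base imageI)
    finally have "proj_point T \<in> proj_span (veronese 4 ` (X - {x}))"
      using iff[of "X - {x}" r 4] assms(4) by auto
    with assms(3) x show False unfolding minimal_for_def by blast
  qed
  with \<alpha> that show thesis by blast
qed

text \<open>Both sums are merged into one relation over \<open>A \<union> B\<close> by extending the
  coefficients by zero; on common points they are subtracted.\<close>

lemma polarization_eq:
  assumes AB: "finite A" "finite B" "A \<subseteq> forms 1 n" "B \<subseteq> forms 1 n"
    and eq: "(\<Sum>a\<in>A. pscale (\<alpha> a) (a ^ 4)) = (\<Sum>b\<in>B. pscale (\<beta> b) (b ^ 4))"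
    and h: "functional h1" "functional h2" "functional h3" "functional h4"
  shows "(\<Sum>a\<in>A. \<alpha> a * (h1 a * h2 a * h3 a * h4 a)) = (\<Sum>b\<in>B. \<beta> b * (h1 b * h2 b * h3 b * h4 b))"
proof -
  let ?c = "\<lambda>z. (if z \<in> A then \<alpha> z else 0) - (if z \<in> B then \<beta> z else 0)"
  have restrict: "(\<Sum>z\<in>A \<union> B. f (if z \<in> X then g z else 0) z) = (\<Sum>z\<in>X. f (g z) z)"
    if "X \<subseteq> A \<union> B" "\<And>z. f 0 z = 0" for f :: "complex \<Rightarrow> mpoly \<Rightarrow> 'x::comm_monoid_add" and g X
    using that AB(1,2) by (intro sum.mono_neutral_cong_right) auto
  have "(\<Sum>z\<in>A \<union> B. pscale (?c z) (z ^ 4)) = 0"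
    using eq restrict[of A "\<lambda>c z. pscale c (z ^ 4)" \<alpha>] restrict[of B "\<lambda>c z. pscale c (z ^ 4)" \<beta>]
    by (simp add: mp.scale_left_diff_distrib sum_subtractf)
  then have "(\<Sum>z\<in>A \<union> B. ?c z * (h1 z * h2 z * h3 z * h4 z)) = 0"
    using AB h by (intro polarization[of _ n]) auto
  then show ?thesis
    using restrict[of A "\<lambda>c z. c * (h1 z * h2 z * h3 z * h4 z)" \<alpha>]
      restrict[of B "\<lambda>c z. c * (h1 z * h2 z * h3 z * h4 z)" \<beta>]
    by (simp add: left_diff_distrib sum_subtractf)
qed

text \<open>Equal cardinality keeps \<open>B\<close> from lying inside \<open>A\<close>. With a
  single new point \<open>b\<close>, the quartic identity could be solved for the fourth power of
  \<open>b\<close>, which \<open>no_quartic_relation\<close> forbids.\<close>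

lemma (in general_position) two_new_points:
  assumes B: "finite B" "card B = 2 * n + 1" "B \<noteq> A"
    and new: "\<And>b. b \<in> B - A \<Longrightarrow> new_point b" "\<And>b. b \<in> B - A \<Longrightarrow> \<exists>N. square_relation b N"
    and \<beta>: "\<And>b. b \<in> B \<Longrightarrow> \<beta> b \<noteq> 0"
    and q: "\<And>h1 h2 h3 h4. functional h1 \<Longrightarrow> functional h2 \<Longrightarrow> functional h3 \<Longrightarrow> functional h4 \<Longrightarrow>
      (\<Sum>a\<in>A. \<alpha> a * (h1 a * h2 a * h3 a * h4 a)) = (\<Sum>b\<in>B. \<beta> b * (h1 b * h2 b * h3 b * h4 b))"
  obtains b b' where "b \<in> B - A" "b' \<in> B - A" "b \<noteq> b'"
proof -
  have "\<not> B \<subseteq> A" using B card_A finite_A card_subset_eq by metis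
  then obtain b where b: "b \<in> B - A" by blast
  have "\<exists>b'\<in>B - A. b' \<noteq> b"
  proof (rule ccontr)
    assume "\<not> ?thesis"
    with b have BA: "B = insert b (B \<inter> A)" by blast
    obtain N where N: "square_relation b N" using new(2)[OF b] by blast
    let ?c = "\<lambda>a. (\<alpha> a - (if a \<in> B then \<beta> a else 0)) / \<beta> b"
    show False
    proof (rule no_quartic_relation[OF new(1)[OF b] N, of ?c])
      fix h1 h2 h3 h4
      assume h: "functional h1" "functional h2" "functional h3" "functional h4"
      let ?h = "\<lambda>x. h1 x * h2 x * h3 x * h4 x"
      have "(\<Sum>a\<in>A. \<alpha> a * ?h a) = (\<Sum>x\<in>insert b (B \<inter> A). \<beta> x * ?h x)"
        using q[OF h] BA by simp
      also have "\<dots> = \<beta> b * ?h b + (\<Sum>x\<in>B \<inter> A. \<beta> x * ?h x)"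
        using b B(1) by (subst sum.insert) auto
      also have "(\<Sum>x\<in>B \<inter> A. \<beta> x * ?h x) = (\<Sum>a\<in>A. (if a \<in> B then \<beta> a else 0) * ?h a)"
        using finite_A by (intro sum.mono_neutral_cong_left) auto
      finally have "\<beta> b * ?h b = (\<Sum>a\<in>A. (\<alpha> a - (if a \<in> B then \<beta> a else 0)) * ?h a)"
        by (simp only: left_diff_distrib sum_subtractf) simp
      then have "?h b = (\<Sum>a\<in>A. (\<alpha> a - (if a \<in> B then \<beta> a else 0)) * ?h a) / \<beta> b"
        using \<beta>[of b] b by (metis DiffD1 nonzero_mult_div_cancel_left)
      then show "?h b = (\<Sum>a\<in>A. ?c a * ?h a)"
        by (simp add: sum_divide_distrib)
    qed
  qed
  with b that show thesis by blast
qed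

section \<open>The theorem for projective points\<close>

theorem theorem6p2:
  fixes n :: nat and T :: mpoly and A B :: "mpoly set set"
  assumes "n \<ge> 1"
    and "T \<in> forms 4 n" and "T \<noteq> 0"
    and "computes n A T" and "card A = 2 * n + 1"
    and "linear_general_position n A" and "minimal_for A T"
    and "B \<noteq> A"
    and "computes n B T" and "card B \<le> 2 * n + 1" and "minimal_for B T"
  shows "\<exists>C. rational_normal_curve n C \<and> A \<union> B \<subseteq> C"
proof -
  have AB: "A \<subseteq> Pn n" "B \<subseteq> Pn n" "finite A" "finite B"
    using assms unfolding computes_def by auto
  have "\<forall>x\<in>Pn n. \<exists>v. v \<in> forms 1 n \<and> v \<noteq> 0 \<and> x = proj_point v"
    unfolding Pn_def proj_def by blast
  \<comment> \<open>\<open>r\<close> fixes one representative of every point, and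
    \<open>proj_point\<close> recovers the point from it.\<close>
  then obtain r where r: "\<And>x. x \<in> Pn n \<Longrightarrow> r x \<in> forms 1 n" "\<And>x. x \<in> Pn n \<Longrightarrow> r x \<noteq> 0"
    "\<And>x. x \<in> Pn n \<Longrightarrow> x = proj_point (r x)"
    by metis
  have inj: "inj_on r (Pn n)" using r(3) by (metis inj_onI)
  have rep: "x = proj_point (r x)" if "x \<in> A \<or> x \<in> B" for x using that r(3) AB by blast
  have injA: "inj_on r A" and injB: "inj_on r B" using inj AB inj_on_subset by blast+
  obtain \<alpha> where \<alpha>: "T = (\<Sum>x\<in>A. pscale (\<alpha> x) (r x ^ 4))" "\<And>x. x \<in> A \<Longrightarrow> \<alpha> x \<noteq> 0"
    using minimal_representation[OF assms(3,4,7), of r] rep by blast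
  obtain \<beta> where \<beta>: "T = (\<Sum>x\<in>B. pscale (\<beta> x) (r x ^ 4))" "\<And>x. x \<in> B \<Longrightarrow> \<beta> x \<noteq> 0"
    using minimal_representation[OF assms(3,9,11), of r] rep by blast
  have forms: "r ` A \<subseteq> forms 1 n" "r ` B \<subseteq> forms 1 n" using r(1) AB by auto
  interpret general_position n "r ` A"
  proof
    show "card (r ` A) = 2 * n + 1" using injA assms(5) by (simp add: card_image)
    fix S assume S: "S \<subseteq> r ` A" "card S \<le> n + 1"
    then obtain S' where S': "S' \<subseteq> A" "S = r ` S'" by (auto simp: subset_image_iff)
    have "card S' \<le> min (card A) (n + 1)"
      using S S' injA assms(5) by (simp add: card_image inj_on_subset)
    then have "points_independent S'"
      using S'(1) assms(6) unfolding linear_general_position_def by blast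
    moreover have "r x \<in> x - {0}" if "x \<in> S'" for x
      using that S'(1) AB(1) r(2)[of x] rep[of x] proj_point_self[of "r x"] by auto
    ultimately show "mp.independent S"
      unfolding points_independent_def S'(2) by blast
  qed (rule forms(1))
  \<comment> \<open>The coefficients are indexed by points, so a vector finds its own through
    \<open>proj_point\<close>.\<close>
  have quartic: "(\<Sum>a\<in>r ` A. \<alpha> (proj_point a) * (h1 a * h2 a * h3 a * h4 a)) =
      (\<Sum>b\<in>r ` B. \<beta> (proj_point b) * (h1 b * h2 b * h3 b * h4 b))"
    if "functional h1" "functional h2" "functional h3" "functional h4" for h1 h2 h3 h4
  proof (rule polarization_eq[OF _ _ forms _ that])
    have "(\<Sum>a\<in>r ` A. pscale (\<alpha> (proj_point a)) (a ^ 4)) = T"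
      unfolding sum.reindex[OF injA] \<alpha>(1) using rep by (intro sum.cong) auto
    moreover have "(\<Sum>b\<in>r ` B. pscale (\<beta> (proj_point b)) (b ^ 4)) = T"
      unfolding sum.reindex[OF injB] \<beta>(1) using rep by (intro sum.cong) auto
    ultimately show "(\<Sum>a\<in>r ` A. pscale (\<alpha> (proj_point a)) (a ^ 4)) =
      (\<Sum>b\<in>r ` B. pscale (\<beta> (proj_point b)) (b ^ 4))" by simp
  qed (use AB in auto)
  have \<alpha>': "\<alpha> (proj_point a) \<noteq> 0" if "a \<in> r ` A" for a
    using that \<alpha>(2) rep by force
  have \<beta>': "\<beta> (proj_point b) \<noteq> 0" if "b \<in> r ` B" for b
    using that \<beta>(2) rep by force
  have finB: "finite (r ` B)" using AB by simp
  have cardB: "card (r ` B) \<le> 2 * n + 1" using assms(10) card_image_le[OF AB(4), of r] by simp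
  note sq = square_relations[OF finB cardB \<alpha>' quartic]
  \<comment> \<open>Proportional nonzero vectors represent the same point, for which
    \<open>r\<close> has chosen only one vector.\<close>
  have proportional: "v = w" if vw: "v \<in> r ` A \<union> r ` B" "w \<in> r ` A \<union> r ` B" "w = pscale c v" for v w c
  proof -
    obtain x y where xy: "x \<in> Pn n" "y \<in> Pn n" "v = r x" "w = r y" using vw(1,2) AB by blast
    then have "c \<noteq> 0" using vw(3) r(2)[of y] by auto
    then show ?thesis using xy vw(3) r(3) proj_point_pscale by metis
  qed
  have new: "new_point b" if "b \<in> r ` B - r ` A" for b
    unfolding new_point_def
  proof (intro conjI ballI allI notI)
    show "b \<in> forms 1 n" using that forms(2) by blast
    fix a c assume a: "a \<in> r ` A" "b = pscale c a"
    have "a = b" by (rule proportional[OF _ _ a(2)]) (use a(1) that in \<open>simp_all\<close>)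
    with a(1) that show False by simp
  qed
  have ne: "r ` B \<noteq> r ` A"
    using assms(8) inj AB inj_on_image_eq_iff by metis
  obtain b b' where b: "b \<in> r ` B - r ` A" "b' \<in> r ` B - r ` A" "b \<noteq> b'"
    using two_new_points[OF finB sq(1) ne new _ \<beta>' quartic] sq(2) by blast
  obtain E \<epsilon> where "based_general_position n (r ` A) E \<epsilon>" by (rule based_general_position)
  then interpret based_general_position n "r ` A" E \<epsilon> .
  obtain C where C: "rational_normal_curve n C"
    "\<And>x. x \<in> r ` A \<union> (r ` B - r ` A) \<Longrightarrow> proj_point x \<in> C"
  proof (rule curve_through[OF assms(1) new _ _ b])
    show "\<exists>N. square_relation b N" if "b \<in> r ` B - r ` A" for b using sq(2) that by blast
    show "b' \<noteq> pscale c b" if "b \<in> r ` B - r ` A" "b' \<in> r ` B - r ` A" "b \<noteq> b'" for b b' c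
      using that proportional[of b b'] by blast
  qed blast+
  have "x \<in> C" if "x \<in> A \<union> B" for x
    using C(2)[of "r x"] rep[of x] that by auto
  then show ?thesis using C(1) by blast
qed

end
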